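(* Let $\mathfrak g$ be a 2-step nilpotent Lie algebra of dimension $d<\infty$ with first Betti number equal to $b$, and let $\alpha(\mathfrak g)$ be its independence number. 1) If $d<b+1$, then $\alpha(\mathfrak g)=d$. 2) If $d=b+1$, then $\alpha(\mathfrak g)\ge\frac{d-1}{2}$. 3) If $d>b+1$, then $$\alpha(\mathfrak g)\ge\frac{\sqrt{4(d-b-1)(b^2+b)+(d+b+1)^2}-(d+b+1)}{2(d-b-1)}\,.$$
   Context: 2-step nilpotent Lie algebra: a real vector space $\mathfrak g$ with an antisymmetric bilinear bracket $[\,,\,]:\mathfrak g\times\mathfrak g\to\mathfrak g$ such that $[x,[y,z]]=0$ for all $x,y,z\in\mathfrak g$ (abelian Lie algebras are included). Cohomology: the Cartan-Chevalley-Eilenberg complex of $\mathfrak g$ is the exterior algebra $\mathcal C^\bullet(\mathfrak g)=\bigwedge^\bullet\mathfrak g^\vee$ of the dual of $\mathfrak g$, with differential the odd derivation determined by $d(\varphi)(x,y)=\varphi([x,y])$ for $\varphi\in\mathfrak g^\vee$, $x,y\in\mathfrak g$ (this differential is not to be confused with the dimension $d$). $H^\bullet(\mathfrak g)$ is its cohomology, and the first Betti number is $b=b^1(\mathfrak g)=\dim H^1(\mathfrak g)$. Basic cohomology: let $\pi:\mathfrak g\to\mathfrak g/[\mathfrak g,\mathfrak g]$ be the canonical quotient map. $H^\bullet_B(\mathfrak g)$ is the image of the induced linear map $\pi^\bullet:H^\bullet(\mathfrak g/[\mathfrak g,\mathfrak g])\to H^\bullet(\mathfrak g)$, and $b^k_B(\mathfrak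 g)=\dim H^k_B(\mathfrak g)$. Independence number: $\alpha(\mathfrak g)$ is the largest integer $k$ such that $b^k_B(\mathfrak g)\ne0$. *)

theory Defs
  imports Complex_Main "HOL-Algebra.AbelCoset" "Jordan_Normal_Form.VS_Connect"
begin

abbreviation real_field :: "real ring" where
  "real_field \<equiv> class_ring"

subsection \<open>Two-step nilpotent Lie algebras\<close>

record 'a lie_algebra = "(real, 'a) module" +
  lie_bracket :: "'a \<Rightarrow> 'a \<Rightarrow> 'a" (\<open>\<lbrakk>_,/ _\<rbrakk>\<index>\<close>)

text \<open>The Jacobi identity is not listed: for two-step nilpotent brackets each of its terms vanishes.\<close>

locale two_step_nilpotent_lie_algebra = vectorspace real_field g
  for g :: "('a, 'm) lie_algebra_scheme" (structure) +
  assumes bracket_closed: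
      "\<lbrakk>x \<in> carrier g; y \<in> carrier g\<rbrakk> \<Longrightarrow> \<lbrakk>x, y\<rbrakk> \<in> carrier g"
    and bracket_add_left:
      "\<lbrakk>x \<in> carrier g; y \<in> carrier g; z \<in> carrier g\<rbrakk> \<Longrightarrow> \<lbrakk>x \<oplus> y, z\<rbrakk> = \<lbrakk>x, z\<rbrakk> \<oplus> \<lbrakk>y, z\<rbrakk>"
    and bracket_smult_left:
      "\<lbrakk>x \<in> carrier g; y \<in> carrier g\<rbrakk> \<Longrightarrow> \<lbrakk>r \<odot>\<^bsub>g\<^esub> x, y\<rbrakk> = r \<odot>\<^bsub>g\<^esub> \<lbrakk>x, y\<rbrakk>"
    and bracket_add_right:
      "\<lbrakk>x \<in> carrier g; y \<in> carrier g; z \<in> carrier g\<rbrakk> \<Longrightarrow> \<lbrakk>x, y \<oplus> z\<rbrakk> = \<lbrakk>x, y\<rbrakk> \<oplus> \<lbrakk>x, z\<rbrakk>"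
    and bracket_smult_right:
      "\<lbrakk>x \<in> carrier g; y \<in> carrier g\<rbrakk> \<Longrightarrow> \<lbrakk>x, r \<odot>\<^bsub>g\<^esub> y\<rbrakk> = r \<odot>\<^bsub>g\<^esub> \<lbrakk>x, y\<rbrakk>"
    and bracket_antisym:
      "\<lbrakk>x \<in> carrier g; y \<in> carrier g\<rbrakk> \<Longrightarrow> \<lbrakk>x, y\<rbrakk> = \<ominus> \<lbrakk>y, x\<rbrakk>"
    and two_step:
      "\<lbrakk>x \<in> carrier g; y \<in> carrier g; z \<in> carrier g\<rbrakk> \<Longrightarrow> \<lbrakk>x, \<lbrakk>y, z\<rbrakk>\<rbrakk> = \<zero>"

definition derived_algebra :: "('a, 'm) lie_algebra_scheme \<Rightarrow> 'a set" where
  "derived_algebra g = LinearCombinations.module.span real_field g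
     {\<lbrakk>x, y\<rbrakk>\<^bsub>g\<^esub> | x y. x \<in> carrier g \<and> y \<in> carrier g}"

subsection \<open>Quotients\<close>

text \<open>
  Elements of a quotient are cosets, and operations are given by unions over representatives;
  the coset of \<open>r \<odot> x\<close> is used rather than the image of the coset of \<open>x\<close> under scaling, as the
  latter fails to be a coset for \<open>r = 0\<close>. The multiplication and unit inherited from the ring record
  play no role in a vector space.
\<close>

definition quotient_space :: "(real, 'a, 'm) module_scheme \<Rightarrow> 'a set \<Rightarrow> (real, 'a set) module" where
  "quotient_space V W =
     \<lparr>carrier = a_rcosets\<^bsub>V\<^esub> W, mult = undefined, one = undefined,
      zero = W, add = set_add V,
      smult = (\<lambda>r X. \<Union>x\<in>X. W +>\<^bsub>V\<^esub> (r \<odot>\<^bsub>V\<^esub> x))\<rparr>"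

definition quotient_lie_algebra ::
  "('a, 'm) lie_algebra_scheme \<Rightarrow> 'a set \<Rightarrow> 'a set lie_algebra" where
  "quotient_lie_algebra g I = module.extend (quotient_space g I)
     (lie_algebra.fields (\<lambda>X Y. \<Union>x\<in>X. \<Union>y\<in>Y. I +>\<^bsub>g\<^esub> \<lbrakk>x, y\<rbrakk>\<^bsub>g\<^esub>))"

definition abelianization :: "('a, 'm) lie_algebra_scheme \<Rightarrow> 'a set lie_algebra" where
  "abelianization g = quotient_lie_algebra g (derived_algebra g)"

definition abelianization_map :: "('a, 'm) lie_algebra_scheme \<Rightarrow> 'a \<Rightarrow> 'a set" where
  "abelianization_map g x = derived_algebra g +>\<^bsub>g\<^esub> x"

subsection \<open>The Cartan-Chevalley-Eilenberg complex\<close>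

text \<open>
  The degree \<open>k\<close> part of the exterior algebra of the dual is the space of alternating
  \<open>k\<close>-linear forms. A form takes the list of its arguments, and is \<open>0\<close> on lists
  of the wrong length or with entries outside the carrier, so that forms are equal iff they
  agree on their proper arguments.
\<close>

definition alternating_forms :: "(real, 'a, 'm) module_scheme \<Rightarrow> nat \<Rightarrow> ('a list \<Rightarrow> real) set" where
  "alternating_forms V k = {\<omega>.
     (\<forall>xs. \<not> (length xs = k \<and> set xs \<subseteq> carrier V) \<longrightarrow> \<omega> xs = 0) \<and>
     (\<forall>xs. length xs = k \<and> set xs \<subseteq> carrier V \<longrightarrow>
        (\<forall>i<k. \<forall>x\<in>carrier V. \<forall>y\<in>carrier V.
           \<omega> (xs[i := x \<oplus>\<^bsub>V\<^esub> y]) = \<omega> (xs[i := x]) + \<omega> (xs[i := y])) \<and>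
        (\<forall>i<k. \<forall>r. \<forall>x\<in>carrier V. \<omega> (xs[i := r \<odot>\<^bsub>V\<^esub> x]) = r * \<omega> (xs[i := x])) \<and>
        (\<forall>i<k. \<forall>j<k. i \<noteq> j \<and> xs ! i = xs ! j \<longrightarrow> \<omega> xs = 0))}"

definition cochains :: "(real, 'a, 'm) module_scheme \<Rightarrow> nat \<Rightarrow> (real, 'a list \<Rightarrow> real) module" where
  "cochains V k =
     \<lparr>carrier = alternating_forms V k, mult = undefined, one = undefined,
      zero = (\<lambda>_. 0), add = (\<lambda>\<omega> \<eta> xs. \<omega> xs + \<eta> xs),
      smult = (\<lambda>r \<omega> xs. r * \<omega> xs)\<rparr>"

text \<open>
  The sign \<open>(-1) ^ (i + j + 1)\<close> (indices start at \<open>0\<close>) makes \<open>(d \<phi>) (x, y) = \<phi> [x, y]\<close> in degree one.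
  That this is the odd derivation so determined is \<open>ce_differential_one_form\<close> together with
  \<open>ce_differential_wedge\<close> below.
\<close>

definition ce_differential ::
  "('a, 'm) lie_algebra_scheme \<Rightarrow> ('a list \<Rightarrow> real) \<Rightarrow> 'a list \<Rightarrow> real" where
  "ce_differential g \<omega> xs =
     (if set xs \<subseteq> carrier g
      then \<Sum>j<length xs. \<Sum>i<j.
             (-1) ^ (i + j + 1) * \<omega> (\<lbrakk>xs ! i, xs ! j\<rbrakk>\<^bsub>g\<^esub> # nths xs (- {i, j}))
      else 0)"

subsection \<open>Cohomology and basic cohomology\<close>

definition cocycles :: "('a, 'm) lie_algebra_scheme \<Rightarrow> nat \<Rightarrow> ('a list \<Rightarrow> real) set" where
  "cocycles g k = {\<omega> \<in> alternating_forms g k. ce_differential g \<omega> = (\<lambda>_. 0)}"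

definition coboundaries :: "('a, 'm) lie_algebra_scheme \<Rightarrow> nat \<Rightarrow> ('a list \<Rightarrow> real) set" where
  "coboundaries g k =
     (case k of 0 \<Rightarrow> {\<lambda>_. 0} | Suc j \<Rightarrow> ce_differential g ` alternating_forms g j)"

definition cohomology ::
  "('a, 'm) lie_algebra_scheme \<Rightarrow> nat \<Rightarrow> (real, ('a list \<Rightarrow> real) set) module" where
  "cohomology g k =
     quotient_space (cochains g k\<lparr>carrier := cocycles g k\<rparr>) (coboundaries g k)"

definition betti_number :: "('a, 'm) lie_algebra_scheme \<Rightarrow> nat \<Rightarrow> nat" where
  "betti_number g k = vectorspace.dim real_field (cohomology g k)"

definition pullback_form ::
  "('a, 'm) lie_algebra_scheme \<Rightarrow> ('a \<Rightarrow> 'b) \<Rightarrow> ('b list \<Rightarrow> real) \<Rightarrow> 'a list \<Rightarrow> real" where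
  "pullback_form g f \<omega> xs = (if set xs \<subseteq> carrier g then \<omega> (map f xs) else 0)"

text \<open>The induced map sends a class \<open>X\<close>, which is a set of cocycles, to the class of the pullback of
  any representative of \<open>X\<close>.\<close>

definition cohomology_map ::
  "('a, 'm) lie_algebra_scheme \<Rightarrow> ('a \<Rightarrow> 'b) \<Rightarrow> nat \<Rightarrow> ('b list \<Rightarrow> real) set \<Rightarrow> ('a list \<Rightarrow> real) set"
where
  "cohomology_map g f k X =
     (\<Union>\<omega>\<in>X. coboundaries g k +>\<^bsub>cochains g k\<^esub> pullback_form g f \<omega>)"

definition basic_cohomology ::
  "('a, 'm) lie_algebra_scheme \<Rightarrow> nat \<Rightarrow> (real, ('a list \<Rightarrow> real) set) module" where
  "basic_cohomology g k = cohomology g k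
     \<lparr>carrier := cohomology_map g (abelianization_map g) k ` carrier (cohomology (abelianization g) k)\<rparr>"

definition basic_betti_number :: "('a, 'm) lie_algebra_scheme \<Rightarrow> nat \<Rightarrow> nat" where
  "basic_betti_number g k = vectorspace.dim real_field (basic_cohomology g k)"

definition independence_number :: "('a, 'm) lie_algebra_scheme \<Rightarrow> nat" where
  "independence_number g = (GREATEST k. basic_betti_number g k \<noteq> 0)"

subsection \<open>The differential as an odd derivation\<close>

text \<open>The exterior product is the sum over all shuffles; \<open>I\<close> is the set of positions of the
  arguments of \<open>\<omega>\<close>, and the sign is that of the shuffle, computed by counting inversions.\<close>

definition wedge :: "('a list \<Rightarrow> real) \<Rightarrow> ('a list \<Rightarrow> real) \<Rightarrow> 'a list \<Rightarrow> real" where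
  "wedge \<omega> \<eta> xs =
     (\<Sum>I\<in>Pow {..<length xs}.
        (-1) ^ card {(i, j). i \<in> I \<and> j \<notin> I \<and> j < i} * \<omega> (nths xs I) * \<eta> (nths xs (- I)))"

lemma ce_differential_one_form:
  assumes "x \<in> carrier g" and "y \<in> carrier g"
  shows "ce_differential g \<phi> [x, y] = \<phi> [\<lbrakk>x, y\<rbrakk>\<^bsub>g\<^esub>]"
  using assms by (simp add: ce_differential_def nths_Cons)

text \<open>Recursion on the argument list replaces the reindexing of signed sums in the proof of the
  derivation rule.\<close>

primrec extract1 :: "('a \<Rightarrow> 'a list \<Rightarrow> real) \<Rightarrow> 'a list \<Rightarrow> real" where
  "extract1 f [] = 0"
| "extract1 f (x # xs) = f x xs - extract1 (\<lambda>y ys. f y (x # ys)) xs"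

primrec extract2 :: "('a \<Rightarrow> 'a \<Rightarrow> 'a list \<Rightarrow> real) \<Rightarrow> 'a list \<Rightarrow> real" where
  "extract2 f [] = 0"
| "extract2 f (x # xs) = extract1 (f x) xs + extract2 (\<lambda>y z ys. f y z (x # ys)) xs"

definition twist :: "('a list \<Rightarrow> real) \<Rightarrow> 'a list \<Rightarrow> real" where
  "twist f xs = (-1) ^ length xs * f xs"

primrec wedge_rec :: "('a list \<Rightarrow> real) \<Rightarrow> ('a list \<Rightarrow> real) \<Rightarrow> 'a list \<Rightarrow> real" where
  "wedge_rec f h [] = f [] * h []"
| "wedge_rec f h (x # xs) =
     wedge_rec (\<lambda>ys. f (x # ys)) h xs + wedge_rec (twist f) (\<lambda>ys. h (x # ys)) xs"

lemma extract1_eq_sum: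
  "extract1 f xs = (\<Sum>i<length xs. (-1) ^ i * f (xs ! i) (nths xs (- {i})))"
proof (induction xs arbitrary: f)
  case (Cons x xs)
  have *: "nths (x # xs) (- {Suc i}) = x # nths xs (- {i})" for i
    by (simp add: nths_Cons Compl_eq)
  have "nths (x # xs) (- {0}) = xs"
    by (simp add: nths_Cons nths_all)
  then show ?case
    by (simp add: Cons.IH sum.lessThan_Suc_shift * sum_negf del: sum.lessThan_Suc)
qed simp

lemma extract2_eq_sum:
  "extract2 f xs =
     (\<Sum>j<length xs. \<Sum>i<j. (-1) ^ (i + j + 1) * f (xs ! i) (xs ! j) (nths xs (- {i, j})))"
proof (induction xs arbitrary: f)
  case (Cons x xs)
  have *: "nths (x # xs) (- {Suc i, Suc j}) = x # nths xs (- {i, j})" for i j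
    by (simp add: nths_Cons Compl_eq)
  have **: "nths (x # xs) (- {0, Suc j}) = nths xs (- {j})" for j
    by (simp add: nths_Cons Compl_eq)
  show ?case
    by (simp add: Cons.IH extract1_eq_sum sum.lessThan_Suc_shift * ** sum.distrib
        del: sum.lessThan_Suc)
qed simp

lemma extract1_add: "extract1 (\<lambda>y ys. f y ys + h y ys) xs = extract1 f xs + extract1 h xs"
  by (induction xs arbitrary: f h) auto

lemma extract1_minus: "extract1 (\<lambda>y ys. - f y ys) xs = - extract1 f xs"
  by (induction xs arbitrary: f) auto

lemma extract2_add:
  "extract2 (\<lambda>y z ys. f y z ys + h y z ys) xs = extract2 f xs + extract2 h xs"
  by (induction xs arbitrary: f h) (auto simp: extract1_add)

lemma extract2_minus: "extract2 (\<lambda>y z ys. - f y z ys) xs = - extract2 f xs"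
  by (induction xs arbitrary: f) (auto simp: extract1_minus)

lemma wedge_rec_add_left: "wedge_rec (\<lambda>ys. f ys + f' ys) h xs = wedge_rec f h xs + wedge_rec f' h xs"
proof (induction xs arbitrary: f f' h)
  case (Cons x xs)
  have "twist (\<lambda>ys. f ys + f' ys) = (\<lambda>ys. twist f ys + twist f' ys)"
    by (simp add: twist_def fun_eq_iff distrib_left)
  then show ?case by (simp add: Cons.IH)
qed (simp add: distrib_right)

lemma wedge_rec_minus_left: "wedge_rec (\<lambda>ys. - f ys) h xs = - wedge_rec f h xs"
proof (induction xs arbitrary: f h)
  case (Cons x xs)
  have "twist (\<lambda>ys. - f ys) = (\<lambda>ys. - twist f ys)"
    by (simp add: twist_def fun_eq_iff)
  then show ?case by (simp add: Cons.IH)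
qed simp

lemma wedge_rec_add_right: "wedge_rec f (\<lambda>ys. h ys + h' ys) xs = wedge_rec f h xs + wedge_rec f h' xs"
  by (induction xs arbitrary: f h h') (auto simp: distrib_left)

lemma wedge_rec_minus_right: "wedge_rec f (\<lambda>ys. - h ys) xs = - wedge_rec f h xs"
  by (induction xs arbitrary: f h) auto

lemma wedge_rec_diff_left: "wedge_rec (\<lambda>ys. f ys - f' ys) h xs = wedge_rec f h xs - wedge_rec f' h xs"
  using wedge_rec_add_left[of f "\<lambda>ys. - f' ys"] by (simp add: wedge_rec_minus_left)

lemma wedge_rec_diff_right: "wedge_rec f (\<lambda>ys. h ys - h' ys) xs = wedge_rec f h xs - wedge_rec f h' xs"
  using wedge_rec_add_right[of f h "\<lambda>ys. - h' ys"] by (simp add: wedge_rec_minus_right)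

lemma twist_twist [simp]: "twist (twist f) = f"
  by (simp add: twist_def fun_eq_iff flip: power_add mult.assoc)

lemma twist_Cons: "(\<lambda>ys. twist f (x # ys)) = (\<lambda>ys. - twist (\<lambda>zs. f (x # zs)) ys)"
  by (simp add: twist_def fun_eq_iff)

lemma twist_extract1: "twist (extract1 f) = (\<lambda>xs. - extract1 (\<lambda>y. twist (f y)) xs)"
proof
  show "twist (extract1 f) xs = - extract1 (\<lambda>y. twist (f y)) xs" for xs
  proof (induction xs arbitrary: f)
    case (Cons x xs)
    have "extract1 (\<lambda>y. twist (\<lambda>ys. f y (x # ys))) xs = - twist (extract1 (\<lambda>y ys. f y (x # ys))) xs"
      by (simp add: Cons.IH)
    then show ?case by (simp add: twist_Cons extract1_minus) (simp add: twist_def algebra_simps)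
  qed (simp add: twist_def)
qed

lemma twist_extract2: "twist (extract2 f) = extract2 (\<lambda>y z. twist (f y z))"
proof
  show "twist (extract2 f) xs = extract2 (\<lambda>y z. twist (f y z)) xs" for xs
  proof (induction xs arbitrary: f)
    case (Cons x xs)
    have "extract1 (\<lambda>z. twist (f x z)) xs = - twist (extract1 (f x)) xs"
      by (simp add: twist_extract1)
    then show ?case
      by (simp add: twist_Cons extract2_minus Cons.IH[symmetric]) (simp add: twist_def algebra_simps)
  qed (simp add: twist_def)
qed

lemma extract1_wedge_left:
  "extract1 (\<lambda>z. wedge_rec (f z) h) xs = wedge_rec (extract1 f) h xs"
  by (induction xs arbitrary: f h)
    (simp_all add: extract1_add wedge_rec_diff_left wedge_rec_minus_left twist_extract1)

lemma extract2_wedge_left: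
  "extract2 (\<lambda>y z. wedge_rec (f y z) h) xs = wedge_rec (extract2 f) h xs"
  by (induction xs arbitrary: f h)
    (simp_all add: extract2_add wedge_rec_add_left extract1_wedge_left twist_extract2)

lemma extract1_wedge_right:
  "extract1 (\<lambda>z. wedge_rec f (h z)) xs = wedge_rec (twist f) (extract1 h) xs"
  by (induction xs arbitrary: f h)
    (simp_all add: extract1_add wedge_rec_diff_right wedge_rec_minus_left twist_Cons)

lemma extract2_wedge_right:
  "extract2 (\<lambda>y z. wedge_rec f (h y z)) xs = wedge_rec f (extract2 h) xs"
  by (induction xs arbitrary: f h)
    (simp_all add: extract2_add wedge_rec_add_right extract1_wedge_right)

lemma wedge_eq_rec: "wedge \<omega> \<eta> xs = wedge_rec \<omega> \<eta> xs"
proof (induction xs arbitrary: \<omega> \<eta>)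
  case Nil
  show ?case by (simp add: wedge_def)
next
  case (Cons x xs)
  define invs :: "nat set \<Rightarrow> (nat \<times> nat) set"
    where "invs I = {(i, j). i \<in> I \<and> j \<notin> I \<and> j < i}" for I
  define F where "F I = (-1) ^ card (invs I) * \<omega> (nths (x # xs) I) * \<eta> (nths (x # xs) (- I))" for I
  let ?P = "Pow {..<length xs}"
  have fin: "finite J" if "J \<in> ?P" for J
    using that finite_subset[of J "{..<length xs}"] by auto
  have inv_fin: "finite (invs J)" if "J \<in> ?P" for J
  proof (rule finite_subset)
    show "invs J \<subseteq> {..<length xs} \<times> {..<length xs}"
      unfolding invs_def using that by fastforce
  qed simp
  have inv_image: "(i, j) \<in> map_prod Suc Suc ` invs J \<longleftrightarrow>
      (\<exists>i' j'. i = Suc i' \<and> j = Suc j' \<and> i' \<in> J \<and> j' \<notin> J \<and> j' < i')" for i j J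
    by (force simp: invs_def)
  have inv0: "invs (insert 0 (Suc ` J)) = map_prod Suc Suc ` invs J" for J
  proof -
    have "(i, j) \<in> invs (insert 0 (Suc ` J)) \<longleftrightarrow> (i, j) \<in> map_prod Suc Suc ` invs J" for i j
      unfolding inv_image by (cases i; cases j) (auto simp: invs_def inj_image_mem_iff)
    then show ?thesis by auto
  qed
  have invS: "invs (Suc ` J) = (\<lambda>i. (Suc i, 0)) ` J \<union> map_prod Suc Suc ` invs J" for J
  proof -
    have "(i, j) \<in> invs (Suc ` J) \<longleftrightarrow>
        (i, j) \<in> (\<lambda>i. (Suc i, 0)) ` J \<or> (i, j) \<in> map_prod Suc Suc ` invs J" for i j
      unfolding inv_image by (cases i; cases j) (auto simp: invs_def inj_image_mem_iff)
    then show ?thesis by auto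
  qed
  have card0: "card (invs (insert 0 (Suc ` J))) = card (invs J)" for J
    unfolding inv0 by (intro card_image) (auto simp: inj_on_def)
  have cardS: "card (invs (Suc ` J)) = card J + card (invs J)" if "J \<in> ?P" for J
  proof -
    have "card ((\<lambda>i. (Suc i, 0 :: nat)) ` J) = card J"
      and "card (map_prod Suc Suc ` invs J) = card (invs J)"
      by (intro card_image; auto simp: inj_on_def)+
    then show ?thesis
      unfolding invS using fin[OF that] inv_fin[OF that] by (subst card_Un_disjoint) auto
  qed
  have len: "length (nths xs J) = card J" if "J \<in> ?P" for J
    unfolding length_nths using that by (intro arg_cong[of _ _ card]) auto
  have pick0: "nths (x # xs) (insert 0 (Suc ` J)) = x # nths xs J"
    "nths (x # xs) (- insert 0 (Suc ` J)) = nths xs (- J)" for J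
    by (auto simp: nths_Cons inj_image_mem_iff Compl_eq)
  have pickS: "nths (x # xs) (Suc ` J) = nths xs J"
    "nths (x # xs) (- (Suc ` J)) = x # nths xs (- J)" for J
    by (auto simp: nths_Cons inj_image_mem_iff Compl_eq)
  have "Pow {..<Suc (length xs)} =
      (\<lambda>J. insert 0 (Suc ` J)) ` ?P \<union> (\<lambda>J. Suc ` J) ` ?P"
    by (simp add: lessThan_Suc_eq_insert_0 Pow_insert image_Pow_surj[OF refl, symmetric] image_image Un_commute)
  moreover have "((\<lambda>J. insert 0 (Suc ` J)) ` ?P) \<inter> ((\<lambda>J. Suc ` J) ` ?P) = {}"
    by auto
  moreover have "inj_on (\<lambda>J. insert 0 (Suc ` J)) ?P" "inj_on (\<lambda>J. Suc ` J) ?P"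
    by (auto simp: inj_on_def)
  ultimately have "sum F (Pow {..<Suc (length xs)}) =
      (\<Sum>J\<in>?P. F (insert 0 (Suc ` J))) + (\<Sum>J\<in>?P. F (Suc ` J))"
    by (simp add: sum.union_disjoint sum.reindex)
  also have "(\<Sum>J\<in>?P. F (insert 0 (Suc ` J))) = wedge (\<lambda>ys. \<omega> (x # ys)) \<eta> xs"
    unfolding wedge_def inv_def[symmetric] by (intro sum.cong) (auto simp: F_def card0 pick0 simp flip: invs_def)
  also have "(\<Sum>J\<in>?P. F (Suc ` J)) = wedge (twist \<omega>) (\<lambda>ys. \<eta> (x # ys)) xs"
    unfolding wedge_def inv_def[symmetric]
    by (intro sum.cong) (auto simp: F_def cardS pickS twist_def len power_add simp flip: invs_def)
  finally have "sum F (Pow {..<Suc (length xs)}) =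
      wedge_rec (\<lambda>ys. \<omega> (x # ys)) \<eta> xs + wedge_rec (twist \<omega>) (\<lambda>ys. \<eta> (x # ys)) xs"
    by (simp only: Cons.IH)
  moreover have "wedge \<omega> \<eta> (x # xs) = sum F (Pow {..<Suc (length xs)})"
    by (simp add: wedge_def F_def flip: invs_def)
  ultimately show ?case
    by simp
qed

lemma ce_differential_eq_extract2:
  assumes "set xs \<subseteq> carrier g"
  shows "ce_differential g \<omega> xs = extract2 (\<lambda>y z ys. \<omega> (\<lbrakk>y, z\<rbrakk>\<^bsub>g\<^esub> # ys)) xs"
  using assms by (simp add: ce_differential_def extract2_eq_sum)

lemma wedge_cong_carrier:
  assumes "set xs \<subseteq> A"
    and "\<And>ys. set ys \<subseteq> A \<Longrightarrow> \<omega> ys = \<omega>' ys" and "\<And>ys. set ys \<subseteq> A \<Longrightarrow> \<eta> ys = \<eta>' ys"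
  shows "wedge \<omega> \<eta> xs = wedge \<omega>' \<eta>' xs"
proof -
  have "set (nths xs I) \<subseteq> A" for I
    using assms(1) set_nths_subset[of xs I] by blast
  then show ?thesis
    by (simp add: wedge_def assms(2,3))
qed

lemma wedge_eq_0:
  assumes "\<not> set xs \<subseteq> A"
    and "\<And>ys. \<not> set ys \<subseteq> A \<Longrightarrow> \<omega> ys = 0" and "\<And>ys. \<not> set ys \<subseteq> A \<Longrightarrow> \<eta> ys = 0"
  shows "wedge \<omega> \<eta> xs = 0"
proof -
  have "\<omega> (nths xs I) * \<eta> (nths xs (- I)) = 0" for I
  proof -
    have "set xs = set (nths xs I) \<union> set (nths xs (- I))"
      unfolding set_nths set_conv_nth[of xs] by blast
    then show ?thesis using assms by (metis le_sup_iff mult_eq_0_iff)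
  qed
  then show ?thesis
    unfolding wedge_def by (intro sum.neutral) (simp add: mult.assoc)
qed

theorem ce_differential_wedge:
  assumes "\<omega> \<in> alternating_forms g p" and "\<eta> \<in> alternating_forms g q"
  shows "ce_differential g (wedge \<omega> \<eta>) xs =
    wedge (ce_differential g \<omega>) \<eta> xs + (-1) ^ p * wedge \<omega> (ce_differential g \<eta>) xs"
proof (cases "set xs \<subseteq> carrier g")
  case True
  have tw: "twist \<omega> = (\<lambda>ys. (-1) ^ p * \<omega> ys)"
    using assms(1) by (auto simp: twist_def fun_eq_iff alternating_forms_def)
  have scale: "wedge (\<lambda>ys. c * \<omega> ys) h xs = c * wedge \<omega> h xs" for c h
    by (simp add: wedge_def sum_distrib_left mult_ac)
  have "ce_differential g (wedge \<omega> \<eta>) xs =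
      extract2 (\<lambda>y z ys. wedge_rec \<omega> \<eta> (\<lbrakk>y, z\<rbrakk>\<^bsub>g\<^esub> # ys)) xs"
    using True by (simp add: ce_differential_eq_extract2 wedge_eq_rec)
  also have "\<dots> = wedge_rec (extract2 (\<lambda>y z ys. \<omega> (\<lbrakk>y, z\<rbrakk>\<^bsub>g\<^esub> # ys))) \<eta> xs
      + wedge_rec (twist \<omega>) (extract2 (\<lambda>y z ys. \<eta> (\<lbrakk>y, z\<rbrakk>\<^bsub>g\<^esub> # ys))) xs"
    by (simp add: extract2_add extract2_wedge_left extract2_wedge_right)
  also have "\<dots> = wedge (ce_differential g \<omega>) \<eta> xs + (-1) ^ p * wedge \<omega> (ce_differential g \<eta>) xs"
    unfolding tw wedge_eq_rec[symmetric] scale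
    by (intro arg_cong2[of _ _ _ _ "(+)"] arg_cong2[of _ _ _ _ "(*)"] refl wedge_cong_carrier[OF True])
      (simp_all add: ce_differential_eq_extract2)
  finally show ?thesis .
next
  case False
  have "ce_differential g f ys = 0" if "\<not> set ys \<subseteq> carrier g" for f ys
    using that by (simp add: ce_differential_def)
  moreover have "\<omega> ys = 0" "\<eta> ys = 0" if "\<not> set ys \<subseteq> carrier g" for ys
    using that assms by (auto simp: alternating_forms_def)
  ultimately show ?thesis
    using False wedge_eq_0[OF False] by simp
qed

end

theory Submission
  imports Defs
begin

text \<open>
  Write \<open>D = [g, g]\<close>, \<open>Q = g / D\<close>, \<open>n = dim Q\<close> and \<open>c = dim D\<close>. One-cocycles are the linear forms on \<open>g\<close>
  that kill \<open>D\<close>, so \<open>b = n\<close> (\<open>betti_number_1\<close>) and \<open>d = b + c\<close>. A form on \<open>Q\<close> has zero differential,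
  and so the degree \<open>k\<close> part of basic cohomology is the space of alternating forms on \<open>Q\<close>, pulled back
  to \<open>g\<close>, modulo those pullbacks that are coboundaries. It vanishes for \<open>k > n\<close> and is nonzero for
  \<open>k = 0\<close>. Hence \<open>\<alpha> = \<alpha>(g) \<le> n\<close> is well defined, and every alternating \<open>(\<alpha> + 1)\<close>-form on \<open>Q\<close> pulls back
  to some \<open>d \<eta>\<close>.

  The theorem is a dimension count in this degree. Choose \<open>e\<^sub>1, \<dots>, e\<^sub>n\<close> in \<open>g\<close> lifting a basis of \<open>Q\<close> and a
  basis \<open>f\<^sub>1, \<dots>, f\<^sub>c\<close> of \<open>D\<close>. Each term of \<open>(d \<eta>)(e\<^sub>T)\<close>, for a set \<open>T\<close> of \<open>\<alpha> + 1\<close> indices, is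
  \<open>\<plusminus>\<eta>([e\<^sub>i, e\<^sub>j], e\<^sub>S)\<close> with \<open>S = T - {i, j}\<close>, and is therefore a combination of the numbers
  \<open>\<eta>(f\<^sub>l, e\<^sub>S)\<close>, where \<open>S\<close> has \<open>\<alpha> - 1\<close> elements. There are \<open>c (n choose (\<alpha> - 1))\<close> such numbers, while the
  values \<open>\<omega>(e\<^sub>T)\<close> of a form on \<open>Q\<close> can be prescribed at will, by means of determinants. So
  \<open>(n choose (\<alpha> + 1)) \<le> c (n choose (\<alpha> - 1))\<close> (\<open>vanishing_basic_cohomology_bound\<close>), that is,
  \<open>(n - \<alpha>) (n - \<alpha> + 1) \<le> c \<alpha> (\<alpha> + 1)\<close> (\<open>consecutive_product_bound\<close>).

  For \<open>c = 0\<close> this forces \<open>\<alpha> = n = d\<close>; for \<open>c = 1\<close> it says \<open>n - \<alpha> \<le> \<alpha>\<close>; for \<open>c > 1\<close> it is the quadratic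
  inequality \<open>(c - 1) \<alpha>\<^sup>2 + (d + b + 1) \<alpha> \<ge> b\<^sup>2 + b\<close>, whose larger root is the stated bound.
\<close>

section \<open>Linear algebra over the reals\<close>

text \<open>Gaussian elimination: an equation with a nonzero coefficient eliminates one unknown, and so the
  surplus of unknowns over equations survives the induction.\<close>

lemma homogeneous_system_nontrivial_solution:
  fixes M :: "'b \<Rightarrow> 'a \<Rightarrow> real"
  assumes "finite B" and "finite A" and "card B < card A"
  shows "\<exists>x. (\<exists>a\<in>A. x a \<noteq> 0) \<and> (\<forall>b\<in>B. (\<Sum>a\<in>A. M b a * x a) = 0)"
  using assms
proof (induction B arbitrary: A M rule: finite_induct)
  case empty
  then obtain a where "a \<in> A" by (metis all_not_in_conv card.empty less_irrefl)
  then show ?case by (intro exI[of _ "\<lambda>_. 1"]) auto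
next
  case (insert b B)
  show ?case
  proof (cases "\<forall>a\<in>A. M b a = 0")
    case True
    from insert.IH[of A M] insert.prems insert.hyps
    obtain x where "\<exists>a\<in>A. x a \<noteq> 0" "\<forall>b\<in>B. (\<Sum>a\<in>A. M b a * x a) = 0" by auto
    with True show ?thesis by (intro exI[of _ x]) auto
  next
    case False
    then obtain p where p: "p \<in> A" "M b p \<noteq> 0" by blast
    \<comment> \<open>the remaining equations, after solving equation \<open>b\<close> for unknown \<open>p\<close>\<close>
    let ?M = "\<lambda>c a. M c a - M c p * M b a / M b p"
    have "card B < card (A - {p})" using insert p by simp
    from insert.IH[OF _ this, of ?M] insert.prems
    obtain x where x: "\<exists>a\<in>A - {p}. x a \<noteq> 0" "\<forall>c\<in>B. (\<Sum>a\<in>A - {p}. ?M c a * x a) = 0" by auto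
    define s where "s = (\<Sum>a\<in>A - {p}. M b a * x a)"
    define y where "y = x(p := - s / M b p)"
    have split: "(\<Sum>a\<in>A. M c a * y a) = (\<Sum>a\<in>A - {p}. M c a * x a) - M c p * s / M b p" for c
    proof -
      have "(\<Sum>a\<in>A. M c a * y a) = M c p * y p + (\<Sum>a\<in>A - {p}. M c a * y a)"
        using insert.prems p by (intro sum.remove) auto
      also have "(\<Sum>a\<in>A - {p}. M c a * y a) = (\<Sum>a\<in>A - {p}. M c a * x a)"
        by (intro sum.cong) (auto simp: y_def)
      finally show ?thesis by (simp add: y_def)
    qed
    have "(\<Sum>a\<in>A. M b a * y a) = 0"
      unfolding split using p by (simp add: s_def)
    moreover have "(\<Sum>a\<in>A. M c a * y a) = 0" if "c \<in> B" for c
    proof -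
      have "0 = (\<Sum>a\<in>A - {p}. M c a * x a - M c p / M b p * (M b a * x a))"
        using x(2)[rule_format, OF that, symmetric]
        by (elim trans, intro sum.cong refl) (simp add: algebra_simps)
      also have "\<dots> = (\<Sum>a\<in>A. M c a * y a)"
        unfolding split by (simp add: s_def sum_subtractf sum_distrib_left sum_divide_distrib)
      finally show ?thesis by simp
    qed
    moreover have "\<exists>a\<in>A. y a \<noteq> 0" using x(1) by (auto simp: y_def)
    ultimately show ?thesis by blast
  qed
qed

definition linear_functional :: "(real, 'a, 'm) module_scheme \<Rightarrow> ('a \<Rightarrow> real) \<Rightarrow> bool" where
  "linear_functional V L \<longleftrightarrow>
     (\<forall>x\<in>carrier V. \<forall>y\<in>carrier V. L (x \<oplus>\<^bsub>V\<^esub> y) = L x + L y) \<and>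
     (\<forall>r. \<forall>x\<in>carrier V. L (r \<odot>\<^bsub>V\<^esub> x) = r * L x)"

lemma linear_functional_subspace:
  assumes "linear_functional V L" and "W \<subseteq> carrier V"
  shows "linear_functional (V\<lparr>carrier := W\<rparr>) L"
  using assms subsetD[OF assms(2)] by (simp add: linear_functional_def)

text \<open>The vectors \<open>e i\<close> and the functionals \<open>\<psi> i\<close> are dual bases. The expansion of a vector is expressed by
  the values of functionals on it, which keeps sums in \<open>V\<close> itself out of all later arguments.\<close>

definition dual_basis ::
  "(real, 'a, 'm) module_scheme \<Rightarrow> nat \<Rightarrow> (nat \<Rightarrow> 'a) \<Rightarrow> (nat \<Rightarrow> 'a \<Rightarrow> real) \<Rightarrow> bool" where
  "dual_basis V n e \<psi> \<longleftrightarrow>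
     (\<forall>i<n. e i \<in> carrier V) \<and> (\<forall>i<n. linear_functional V (\<psi> i)) \<and>
     (\<forall>i<n. \<forall>j<n. \<psi> i (e j) = (if i = j then 1 else 0)) \<and>
     (\<forall>L. \<forall>x\<in>carrier V. linear_functional V L \<longrightarrow> L x = (\<Sum>i<n. \<psi> i x * L (e i))) \<and>
     (\<forall>x\<in>carrier V. (\<forall>i<n. \<psi> i x = 0) \<longrightarrow> x = \<zero>\<^bsub>V\<^esub>)"

lemma
  assumes "dual_basis V n e \<psi>"
  shows dual_basis_mem: "i < n \<Longrightarrow> e i \<in> carrier V"
    and dual_basis_functional: "i < n \<Longrightarrow> linear_functional V (\<psi> i)"
    and dual_basis_eval: "i < n \<Longrightarrow> j < n \<Longrightarrow> \<psi> i (e j) = (if i = j then 1 else 0)"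
    and dual_basis_expand:
      "linear_functional V L \<Longrightarrow> x \<in> carrier V \<Longrightarrow> L x = (\<Sum>i<n. \<psi> i x * L (e i))"
    and dual_basis_eq_0:
      "x \<in> carrier V \<Longrightarrow> (\<And>i. i < n \<Longrightarrow> \<psi> i x = 0) \<Longrightarrow> x = \<zero>\<^bsub>V\<^esub>"
  using assms unfolding dual_basis_def by blast+

locale real_vectorspace = vectorspace real_field V for V :: "(real, 'a, 'm) module_scheme"
begin

lemma functional_zero:
  assumes "linear_functional V L"
  shows "L \<zero>\<^bsub>V\<^esub> = 0"
proof -
  have "L (\<zero>\<^bsub>V\<^esub> \<oplus>\<^bsub>V\<^esub> \<zero>\<^bsub>V\<^esub>) = L \<zero>\<^bsub>V\<^esub> + L \<zero>\<^bsub>V\<^esub>"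
    using assms M.zero_closed unfolding linear_functional_def by blast
  then show ?thesis by simp
qed

lemma functional_lincomb:
  assumes "linear_functional V L" and "finite A" and "A \<subseteq> carrier V"
  shows "L (lincomb a A) = (\<Sum>v\<in>A. a v * L v)"
  using assms(2,3)
proof (induction A rule: finite_induct)
  case empty
  then show ?case using functional_zero[OF assms(1)] by (simp add: lincomb_def)
next
  case (insert v A)
  have "lincomb a (insert v A) = (a v \<odot>\<^bsub>V\<^esub> v) \<oplus>\<^bsub>V\<^esub> lincomb a A"
    using lincomb_insert[of A a v] insert by simp
  then show ?case using insert assms(1) by (simp add: linear_functional_def)
qed

lemma lincomb_unique:
  assumes "basis \<beta>" and "finite \<beta>" and "lincomb a \<beta> = lincomb a' \<beta>" and "v \<in> \<beta>"
  shows "a v = a' v"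
proof -
  have sub: "\<beta> \<subseteq> carrier V" and li: "lin_indpt \<beta>" using assms(1) by (auto simp: basis_def)
  have "lincomb (\<lambda>v. a v - a' v) \<beta> = lincomb a \<beta> \<ominus>\<^bsub>V\<^esub> lincomb a' \<beta>"
    using lincomb_diff[OF assms(2) sub, of a a'] by (simp add: class_ring_simps)
  also have "\<dots> = \<zero>\<^bsub>V\<^esub>" using sub assms(3) by (simp add: lincomb_closed)
  finally have "(\<lambda>v. a v - a' v) \<in> \<beta> \<rightarrow> {\<zero>\<^bsub>real_field\<^esub>}"
    using not_lindepD[OF li assms(2) subset_refl, of "\<lambda>v. a v - a' v"] by simp
  then show ?thesis using assms(4) by auto
qed

lemma dual_basis_exists:
  assumes "fin_dim"
  obtains e :: "nat \<Rightarrow> 'a" and \<psi> :: "nat \<Rightarrow> 'a \<Rightarrow> real" where "dual_basis V dim e \<psi>"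
proof -
  from finite_basis_exists[OF assms] obtain \<beta> where fin: "finite \<beta>" and bas: "basis \<beta>" by blast
  then have sub: "\<beta> \<subseteq> carrier V" and li: "lin_indpt \<beta>" and gen: "span \<beta> = carrier V"
    by (auto simp: basis_def)
  have "card \<beta> = dim" using dim_basis[OF fin bas] by simp
  then obtain e where e: "bij_betw e {..<dim} \<beta>"
    using ex_bij_betw_nat_finite[OF fin] by (auto simp: atLeast0LessThan)
  define crd where "crd x = (SOME a. lincomb a \<beta> = x)" for x
  have crd: "lincomb (crd x) \<beta> = x" if "x \<in> carrier V" for x
  proof -
    have "\<exists>a. lincomb a \<beta> = x" using finite_in_span[OF fin sub] gen that by blast
    then show ?thesis unfolding crd_def by (rule someI_ex)
  qed
  have crdI: "crd x v = a v" if "lincomb a \<beta> = x" "v \<in> \<beta>" for x a v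
  proof (rule lincomb_unique[OF bas fin _ that(2)])
    have "x \<in> carrier V" using that(1) sub by auto
    then show "lincomb (crd x) \<beta> = lincomb a \<beta>" using crd that by simp
  qed
  have ee: "e i \<in> carrier V" if "i < dim" for i
    using e that sub by (auto simp: bij_betw_def)
  have eb: "e i \<in> \<beta>" if "i < dim" for i
    using e that by (auto simp: bij_betw_def)
  have lin: "linear_functional V (\<lambda>x. crd x (e i))" if "i < dim" for i
    unfolding linear_functional_def
  proof (intro conjI ballI allI)
    fix x y assume xy: "x \<in> carrier V" "y \<in> carrier V"
    show "crd (x \<oplus>\<^bsub>V\<^esub> y) (e i) = crd x (e i) + crd y (e i)"
      using lincomb_sum[OF fin sub, of "crd x" "crd y"] xy crd
      by (intro crdI[OF _ eb[OF that]]) (simp add: class_ring_simps)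
  next
    fix r x assume x: "x \<in> carrier V"
    show "crd (r \<odot>\<^bsub>V\<^esub> x) (e i) = r * crd x (e i)"
      using lincomb_smult[OF sub, of "crd x" r] x crd
      by (intro crdI[OF _ eb[OF that]]) (simp add: class_ring_simps)
  qed
  have expand: "L x = (\<Sum>i<dim. crd x (e i) * L (e i))"
    if "linear_functional V L" "x \<in> carrier V" for L x
  proof -
    have "L x = (\<Sum>v\<in>\<beta>. crd x v * L v)"
      using functional_lincomb[OF that(1) fin sub, of "crd x"] crd[OF that(2)] by simp
    also have "\<dots> = (\<Sum>i<dim. crd x (e i) * L (e i))"
      by (rule sum.reindex_bij_betw[OF e, symmetric])
    finally show ?thesis .
  qed
  have eval: "crd (e j) (e i) = (if i = j then 1 else 0)" if "i < dim" "j < dim" for i j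
  proof -
    have "lincomb (\<lambda>v. if v = e j then 1 else 0) \<beta>
        = (1 \<odot>\<^bsub>V\<^esub> e j) \<oplus>\<^bsub>V\<^esub> lincomb (\<lambda>v. if v = e j then 1 else 0) (\<beta> - {e j})"
      using lincomb_del2[OF fin sub _ eb[OF that(2)], of "\<lambda>v. if v = e j then 1 else 0"] by simp
    also have "lincomb (\<lambda>v. if v = e j then 1 else 0) (\<beta> - {e j}) = \<zero>\<^bsub>V\<^esub>"
      using sub by (intro lincomb_zero) auto
    also have "(1 \<odot>\<^bsub>V\<^esub> e j) \<oplus>\<^bsub>V\<^esub> \<zero>\<^bsub>V\<^esub> = e j" using ee[OF that(2)] smult_one[of "e j"] by simp
    finally have "crd (e j) (e i) = (if e i = e j then 1 else 0)"
      by (rule crdI[OF _ eb[OF that(1)]])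
    also have "e i = e j \<longleftrightarrow> i = j"
      using e that by (auto simp: bij_betw_def inj_on_def)
    finally show ?thesis .
  qed
  have "x = \<zero>\<^bsub>V\<^esub>" if x: "x \<in> carrier V" and 0: "\<forall>i<dim. crd x (e i) = 0" for x
  proof -
    have "crd x v = 0" if v: "v \<in> \<beta>" for v
    proof -
      obtain i where "i < dim" "v = e i" using e v by (auto simp: bij_betw_def)
      then show ?thesis using 0 by simp
    qed
    then have "lincomb (crd x) \<beta> = \<zero>\<^bsub>V\<^esub>" by (intro lincomb_zero[OF sub]) auto
    then show ?thesis using crd[OF x] by simp
  qed
  then have "dual_basis V dim e (\<lambda>i x. crd x (e i))"
    unfolding dual_basis_def using ee lin eval expand by blast
  then show thesis by (rule that)
qed

text \<open>A separating family of functionals embeds \<open>V\<close> linearly into \<open>\<real>\<^sup>N\<close>; more than \<open>card N\<close> vectors admit a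
  nontrivial relation between their images, which then holds in \<open>V\<close>.\<close>

lemma lin_indpt_card_le_separating:
  assumes N: "finite N" and lin: "\<And>n. n \<in> N \<Longrightarrow> linear_functional V (\<lambda>x. l n x)"
    and sep: "\<And>x. x \<in> carrier V \<Longrightarrow> (\<And>n. n \<in> N \<Longrightarrow> l n x = 0) \<Longrightarrow> x = \<zero>\<^bsub>V\<^esub>"
    and A: "A \<subseteq> carrier V" "lin_indpt A"
  shows "finite A \<and> card A \<le> card N"
proof (rule ccontr)
  assume *: "\<not> (finite A \<and> card A \<le> card N)"
  obtain A' where A': "A' \<subseteq> A" "finite A'" "card A' = Suc (card N)"
  proof (cases "finite A")
    case True
    with * have "Suc (card N) \<le> card A" by simp
    from obtain_subset_with_card_n[OF this] True that show thesis by (metis finite_subset)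
  next
    case False
    from infinite_arbitrarily_large[OF this, of "Suc (card N)"] that show thesis by blast
  qed
  then have "card N < card A'" by simp
  from homogeneous_system_nontrivial_solution[OF N A'(2) this, of l]
  obtain a where a: "\<exists>v\<in>A'. a v \<noteq> 0" "\<forall>n\<in>N. (\<Sum>v\<in>A'. l n v * a v) = 0" by blast
  have sub: "A' \<subseteq> carrier V" using A' A by blast
  have "lincomb a A' = \<zero>\<^bsub>V\<^esub>"
  proof (rule sep)
    show "lincomb a A' \<in> carrier V" using sub by auto
    show "l n (lincomb a A') = 0" if "n \<in> N" for n
      using functional_lincomb[OF lin[OF that] A'(2) sub, of a] a(2) that by (simp add: mult.commute)
  qed
  with a(1) have "lin_dep A" using lin_dep_crit[OF A'(2,1), of a] by auto
  with A show False by blast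
qed

lemma fin_dim_if_separating:
  assumes N: "finite N" and lin: "\<And>n. n \<in> N \<Longrightarrow> linear_functional V (\<lambda>x. l n x)"
    and sep: "\<And>x. x \<in> carrier V \<Longrightarrow> (\<And>n. n \<in> N \<Longrightarrow> l n x = 0) \<Longrightarrow> x = \<zero>\<^bsub>V\<^esub>"
  shows "fin_dim"
proof -
  have "\<exists>A. finite A \<and> maximal A (\<lambda>S. S \<subseteq> carrier V \<and> lin_indpt S)"
  proof (rule maximal_exists)
    show "finite A \<and> card A \<le> card N" if "A \<subseteq> carrier V \<and> lin_indpt A" for A
      using that by (intro lin_indpt_card_le_separating[OF N lin sep]) auto
    show "{} \<subseteq> carrier V \<and> lin_indpt {}" by (auto simp: lin_dep_def)
  qed
  then obtain A where "finite A" "basis A" using max_li_is_basis by blast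
  then show ?thesis unfolding fin_dim_def basis_def by blast
qed

lemma subspace_fin_dim:
  assumes "fin_dim" and W: "submodule real_field W V"
  shows "vectorspace.fin_dim real_field (V\<lparr>carrier := W\<rparr>)"
proof -
  interpret W: real_vectorspace "V\<lparr>carrier := W\<rparr>"
    using subspace_is_vs[of W] W vectorspace_axioms
    by (simp add: VectorSpace.subspace_def real_vectorspace_def)
  obtain e \<psi> where db: "dual_basis V dim e \<psi>" using dual_basis_exists[OF assms(1)] .
  have WV: "W \<subseteq> carrier V" by (rule submodule.subset[OF W])
  show ?thesis
  proof (rule W.fin_dim_if_separating[of "{..<dim}" \<psi>])
    show "linear_functional (V\<lparr>carrier := W\<rparr>) (\<psi> i)" if "i \<in> {..<dim}" for i
      using linear_functional_subspace[OF dual_basis_functional[OF db] WV] that by simp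
    show "x = \<zero>\<^bsub>V\<lparr>carrier := W\<rparr>\<^esub>"
      if "x \<in> carrier (V\<lparr>carrier := W\<rparr>)" "\<And>i. i \<in> {..<dim} \<Longrightarrow> \<psi> i x = 0" for x
      using dual_basis_eq_0[OF db, of x] that WV by auto
  qed simp
qed

lemma dim_eqI_dual:
  assumes v: "\<And>i. i < n \<Longrightarrow> v i \<in> carrier V"
    and lin: "\<And>i. i < n \<Longrightarrow> linear_functional V (\<lambda>x. l i x)"
    and dual: "\<And>i j. i < n \<Longrightarrow> j < n \<Longrightarrow> l i (v j) = (if i = j then 1 else 0)"
    and sep: "\<And>x. x \<in> carrier V \<Longrightarrow> (\<And>i. i < n \<Longrightarrow> l i x = 0) \<Longrightarrow> x = \<zero>\<^bsub>V\<^esub>"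
  shows "fin_dim" and "dim = n"
proof -
  have N: "finite {..<n}" by simp
  have lin': "\<And>i. i \<in> {..<n} \<Longrightarrow> linear_functional V (\<lambda>x. l i x)" using lin by simp
  have sep': "\<And>x. x \<in> carrier V \<Longrightarrow> (\<And>i. i \<in> {..<n} \<Longrightarrow> l i x = 0) \<Longrightarrow> x = \<zero>\<^bsub>V\<^esub>" using sep by simp
  show fd: "fin_dim" by (rule fin_dim_if_separating[OF N lin' sep'])
  then obtain \<beta> where \<beta>: "finite \<beta>" "basis \<beta>" using finite_basis_exists by blast
  have "finite \<beta> \<and> card \<beta> \<le> card {..<n}"
    using \<beta>(2) by (intro lin_indpt_card_le_separating[OF N lin' sep']) (auto simp: basis_def)
  then have "dim \<le> n" using dim_basis[OF \<beta>] by simp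
  moreover have "n \<le> dim"
  proof -
    have inj: "inj_on v {..<n}"
    proof (rule inj_onI)
      fix i j assume ij: "i \<in> {..<n}" "j \<in> {..<n}" "v i = v j"
      then have "l i (v j) = 1" using dual[of i i] by simp
      then show "i = j" using dual[of i j] ij by (auto split: if_splits)
    qed
    have sub: "v ` {..<n} \<subseteq> carrier V" using v by auto
    have "lin_indpt (v ` {..<n})"
    proof (rule finite_lin_indpt2)
      fix a assume 0: "lincomb a (v ` {..<n}) = \<zero>\<^bsub>V\<^esub>"
      have "a (v i) = 0" if "i < n" for i
      proof -
        have "0 = (\<Sum>w\<in>v ` {..<n}. a w * l i w)"
          using functional_lincomb[OF lin[OF that] _ sub, of a] 0 functional_zero[OF lin[OF that]]
          by simp
        also have "\<dots> = (\<Sum>j<n. a (v j) * l i (v j))" by (simp add: sum.reindex[OF inj])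
        also have "\<dots> = (\<Sum>j<n. if i = j then a (v j) else 0)"
          using dual that by (intro sum.cong) auto
        also have "\<dots> = a (v i)" using that by simp
        finally show ?thesis by simp
      qed
      then show "\<forall>w\<in>v ` {..<n}. a w = \<zero>\<^bsub>real_field\<^esub>" by auto
    qed (use sub in auto)
    from li_le_dim(2)[OF fd sub this] show ?thesis by (simp add: card_image[OF inj])
  qed
  ultimately show "dim = n" by simp
qed

lemma dim_eq_0_iff:
  assumes "fin_dim"
  shows "dim = 0 \<longleftrightarrow> carrier V = {\<zero>\<^bsub>V\<^esub>}"
proof
  assume "dim = 0"
  from finite_basis_exists[OF assms] obtain \<beta> where \<beta>: "finite \<beta>" "basis \<beta>" by blast
  with \<open>dim = 0\<close> dim_basis[OF \<beta>] have "\<beta> = {}" by simp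
  with \<beta> show "carrier V = {\<zero>\<^bsub>V\<^esub>}" using span_empty by (simp add: basis_def)
next
  assume "carrier V = {\<zero>\<^bsub>V\<^esub>}"
  then have "basis {}" using span_empty by (simp add: basis_def lin_dep_def)
  from dim_basis[OF _ this] show "dim = 0" by simp
qed

end

section \<open>Quotients and spaces of functions\<close>

lemma real_vectorspaceI: "vectorspace real_field V \<Longrightarrow> real_vectorspace V"
  by (simp add: real_vectorspace_def)

lemma submodule_real_vectorspace:
  assumes "vectorspace real_field V" and "submodule real_field W V"
  shows "vectorspace real_field (V\<lparr>carrier := W\<rparr>)"
proof -
  interpret V: vectorspace real_field V by fact
  show ?thesis using assms by (intro V.subspace_is_vs) (simp add: VectorSpace.subspace_def)
qed

lemma real_field_mem: "r \<in> carrier real_field"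
  by simp

context real_vectorspace
begin

context
  fixes W assumes W: "submodule real_field W V"
begin

lemma subspace_additive_subgroup: "abelian_subgroup W V"
proof (rule abelian_subgroupI3)
  show "additive_subgroup W V"
  proof (rule additive_subgroupI, rule group.subgroupI[OF a_group])
    show "W \<subseteq> carrier (add_monoid V)" using submodule.subset[OF W] by simp
    show "W \<noteq> {}" using submodule.zero_closed[OF W] by blast
    show "inv\<^bsub>add_monoid V\<^esub> a \<in> W" if "a \<in> W" for a
    proof -
      have aV: "a \<in> carrier V" using submodule.subset[OF W] that by blast
      have "(- 1) \<odot>\<^bsub>V\<^esub> a \<oplus>\<^bsub>V\<^esub> a = 0 \<odot>\<^bsub>V\<^esub> a"
        using smult_l_distr[of "- 1" 1 a] smult_one[of a] aV by simp
      also have "\<dots> = \<zero>\<^bsub>V\<^esub>" using lmult_0[OF aV] by simp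
      finally have "\<ominus>\<^bsub>V\<^esub> a = (- 1) \<odot>\<^bsub>V\<^esub> a"
        using minus_equality[of "(- 1) \<odot>\<^bsub>V\<^esub> a" a] smult_closed[of "- 1" a] aV by simp
      then show ?thesis
        using submodule.smult_closed[OF W, of "- 1" a] that by (simp add: a_inv_def)
    qed
    show "a \<otimes>\<^bsub>add_monoid V\<^esub> b \<in> W" if "a \<in> W" "b \<in> W" for a b
      using submodule.m_closed[OF W that] by simp
  qed
  show "abelian_group V" by unfold_locales
qed

interpretation W: abelian_subgroup W V by (rule subspace_additive_subgroup)

lemma coset_eq_iff_mem:
  assumes "x \<in> carrier V"
  shows "W +>\<^bsub>V\<^esub> x = W \<longleftrightarrow> x \<in> W"
  using a_coset_join1[OF _ assms W.a_subgroup] a_coset_join2[OF assms W.a_subgroup] by blast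

lemma quotient_carrier: "carrier (quotient_space V W) = (\<lambda>x. W +>\<^bsub>V\<^esub> x) ` carrier V"
  by (auto simp: quotient_space_def A_RCOSETS_def')

lemma quotient_zero: "\<zero>\<^bsub>quotient_space V W\<^esub> = W"
  by (simp add: quotient_space_def)

lemma quotient_add:
  assumes "x \<in> carrier V" and "y \<in> carrier V"
  shows "(W +>\<^bsub>V\<^esub> x) \<oplus>\<^bsub>quotient_space V W\<^esub> (W +>\<^bsub>V\<^esub> y) = W +>\<^bsub>V\<^esub> (x \<oplus>\<^bsub>V\<^esub> y)"
  using W.a_rcos_sum[OF assms] by (simp add: quotient_space_def)

lemma quotient_smult:
  assumes "x \<in> carrier V"
  shows "r \<odot>\<^bsub>quotient_space V W\<^esub> (W +>\<^bsub>V\<^esub> x) = W +>\<^bsub>V\<^esub> (r \<odot>\<^bsub>V\<^esub> x)"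
proof -
  have WV: "W \<subseteq> carrier V" by (rule submodule.subset[OF W])
  have rx: "r \<odot>\<^bsub>V\<^esub> x \<in> carrier V" using smult_closed[OF real_field_mem assms] .
  have *: "W +>\<^bsub>V\<^esub> (r \<odot>\<^bsub>V\<^esub> x') = W +>\<^bsub>V\<^esub> (r \<odot>\<^bsub>V\<^esub> x)" if mem: "x' \<in> W +>\<^bsub>V\<^esub> x" for x'
  proof -
    obtain w where w: "w \<in> W" and x': "x' = w \<oplus>\<^bsub>V\<^esub> x" using mem by (auto simp: a_r_coset_def')
    have "r \<odot>\<^bsub>V\<^esub> x' = (r \<odot>\<^bsub>V\<^esub> w) \<oplus>\<^bsub>V\<^esub> (r \<odot>\<^bsub>V\<^esub> x)"
      unfolding x' using WV w by (intro smult_r_distr[OF real_field_mem _ assms]) (rule subsetD)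
    moreover have "r \<odot>\<^bsub>V\<^esub> w \<in> W" by (rule submodule.smult_closed[OF W real_field_mem w])
    ultimately have "r \<odot>\<^bsub>V\<^esub> x' \<in> W +>\<^bsub>V\<^esub> (r \<odot>\<^bsub>V\<^esub> x)"
      using a_rcosI[OF _ WV rx, of "r \<odot>\<^bsub>V\<^esub> w"] by (simp only:)
    from a_repr_independence[OF this rx W.a_subgroup] show ?thesis by (rule sym)
  qed
  have "r \<odot>\<^bsub>quotient_space V W\<^esub> (W +>\<^bsub>V\<^esub> x) = (\<Union>x'\<in>W +>\<^bsub>V\<^esub> x. W +>\<^bsub>V\<^esub> (r \<odot>\<^bsub>V\<^esub> x'))"
    by (simp add: quotient_space_def)
  also have "\<dots> = (\<Union>x'\<in>W +>\<^bsub>V\<^esub> x. W +>\<^bsub>V\<^esub> (r \<odot>\<^bsub>V\<^esub> x))"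
    by (intro SUP_cong refl *)
  also have "\<dots> = W +>\<^bsub>V\<^esub> (r \<odot>\<^bsub>V\<^esub> x)" using W.a_rcos_self[OF assms] by (intro UN_constant_eq) auto
  finally show ?thesis .
qed

lemma quotient_vectorspace: "vectorspace real_field (quotient_space V W)"
proof (rule vs_criteria)
  show "field real_field" by (rule class_field)
  show "\<zero>\<^bsub>quotient_space V W\<^esub> \<in> carrier (quotient_space V W)"
    unfolding quotient_carrier quotient_zero
    using coset_eq_iff_mem[of "\<zero>\<^bsub>V\<^esub>"] submodule.zero_closed[OF W] by (auto intro!: image_eqI[of _ _ "\<zero>\<^bsub>V\<^esub>"])
  show "\<forall>v\<in>carrier (quotient_space V W). \<exists>neg_v\<in>carrier (quotient_space V W).
      v \<oplus>\<^bsub>quotient_space V W\<^esub> neg_v = \<zero>\<^bsub>quotient_space V W\<^esub>"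
  proof
    fix v assume "v \<in> carrier (quotient_space V W)"
    then obtain x where x: "x \<in> carrier V" "v = W +>\<^bsub>V\<^esub> x" by (auto simp: quotient_carrier)
    then have "v \<oplus>\<^bsub>quotient_space V W\<^esub> (W +>\<^bsub>V\<^esub> (\<ominus>\<^bsub>V\<^esub> x)) = \<zero>\<^bsub>quotient_space V W\<^esub>"
      using quotient_add[of x "\<ominus>\<^bsub>V\<^esub> x"] coset_eq_iff_mem[of "\<zero>\<^bsub>V\<^esub>"] submodule.zero_closed[OF W]
      by (simp add: r_neg quotient_zero)
    then show "\<exists>neg_v\<in>carrier (quotient_space V W).
        v \<oplus>\<^bsub>quotient_space V W\<^esub> neg_v = \<zero>\<^bsub>quotient_space V W\<^esub>"
      using x by (auto simp: quotient_carrier)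
  qed
next
  let ?Q = "quotient_space V W"
  have car: "W +>\<^bsub>V\<^esub> x \<in> carrier ?Q" if "x \<in> carrier V" for x using that by (simp add: quotient_carrier)
  note ops = quotient_carrier quotient_add quotient_smult
  show "\<forall>v w. v \<in> carrier ?Q \<and> w \<in> carrier ?Q \<longrightarrow> v \<oplus>\<^bsub>?Q\<^esub> w \<in> carrier ?Q"
    by (auto simp: ops)
  show "\<forall>c v. c \<in> carrier real_field \<and> v \<in> carrier ?Q \<longrightarrow> c \<odot>\<^bsub>?Q\<^esub> v \<in> carrier ?Q"
    by (auto simp: ops)
  show "\<forall>v w. v \<in> carrier ?Q \<and> w \<in> carrier ?Q \<longrightarrow> v \<oplus>\<^bsub>?Q\<^esub> w = w \<oplus>\<^bsub>?Q\<^esub> v"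
    by (auto simp: ops a_comm)
  show "\<forall>v w x. v \<in> carrier ?Q \<and> w \<in> carrier ?Q \<and> x \<in> carrier ?Q \<longrightarrow>
      (v \<oplus>\<^bsub>?Q\<^esub> w) \<oplus>\<^bsub>?Q\<^esub> x = v \<oplus>\<^bsub>?Q\<^esub> (w \<oplus>\<^bsub>?Q\<^esub> x)"
    by (auto simp: ops a_assoc)
  show "\<forall>v\<in>carrier ?Q. v \<oplus>\<^bsub>?Q\<^esub> \<zero>\<^bsub>?Q\<^esub> = v"
  proof
    fix v assume "v \<in> carrier ?Q"
    then obtain x where x: "x \<in> carrier V" "v = W +>\<^bsub>V\<^esub> x" by (auto simp: quotient_carrier)
    have "\<zero>\<^bsub>?Q\<^esub> = W +>\<^bsub>V\<^esub> \<zero>\<^bsub>V\<^esub>"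
      using coset_eq_iff_mem[of "\<zero>\<^bsub>V\<^esub>"] submodule.zero_closed[OF W] by (simp add: quotient_zero)
    then show "v \<oplus>\<^bsub>?Q\<^esub> \<zero>\<^bsub>?Q\<^esub> = v" using x quotient_add[of x "\<zero>\<^bsub>V\<^esub>"] by simp
  qed
  show "\<forall>a b v. a \<in> carrier real_field \<and> b \<in> carrier real_field \<and> v \<in> carrier ?Q \<longrightarrow>
      (a \<otimes>\<^bsub>real_field\<^esub> b) \<odot>\<^bsub>?Q\<^esub> v = a \<odot>\<^bsub>?Q\<^esub> (b \<odot>\<^bsub>?Q\<^esub> v)"
    using smult_assoc1 by (auto simp: ops)
  show "\<forall>v\<in>carrier ?Q. \<one>\<^bsub>real_field\<^esub> \<odot>\<^bsub>?Q\<^esub> v = v"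
    using smult_one by (auto simp: ops)
  show "\<forall>a b v. a \<in> carrier real_field \<and> b \<in> carrier real_field \<and> v \<in> carrier ?Q \<longrightarrow>
      (a \<oplus>\<^bsub>real_field\<^esub> b) \<odot>\<^bsub>?Q\<^esub> v = (a \<odot>\<^bsub>?Q\<^esub> v) \<oplus>\<^bsub>?Q\<^esub> (b \<odot>\<^bsub>?Q\<^esub> v)"
    using smult_l_distr by (auto simp: ops)
  show "\<forall>a v w. a \<in> carrier real_field \<and> v \<in> carrier ?Q \<and> w \<in> carrier ?Q \<longrightarrow>
      a \<odot>\<^bsub>?Q\<^esub> (v \<oplus>\<^bsub>?Q\<^esub> w) = (a \<odot>\<^bsub>?Q\<^esub> v) \<oplus>\<^bsub>?Q\<^esub> (a \<odot>\<^bsub>?Q\<^esub> w)"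
    using smult_r_distr by (auto simp: ops)
qed

lemma quotient_map_linear:
  "linear_map real_field V (quotient_space V W) (\<lambda>x. W +>\<^bsub>V\<^esub> x)"
proof -
  have "module real_field (quotient_space V W)" "vectorspace real_field (quotient_space V W)"
    using quotient_vectorspace by (auto simp: vectorspace_def)
  moreover have "(\<lambda>x. W +>\<^bsub>V\<^esub> x) \<in> LinearCombinations.module_hom real_field V (quotient_space V W)"
    by (auto simp: LinearCombinations.module_hom_def quotient_carrier quotient_add quotient_smult)
  ultimately show ?thesis
    unfolding linear_map_def mod_hom_def mod_hom_axioms_def
    using vectorspace_axioms module_axioms by blast
qed

end

end

text \<open>Cochains of every degree lie in one ambient space of functions. Cohomology becomes a subspace of the
  quotient of this ambient space by the coboundaries, and basic cohomology a subspace of that.\<close>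

definition function_space :: "(real, 'a \<Rightarrow> real) module" where
  "function_space =
     \<lparr>carrier = UNIV, mult = undefined, one = undefined,
      zero = (\<lambda>_. 0), add = (\<lambda>f h x. f x + h x), smult = (\<lambda>r f x. r * f x)\<rparr>"

lemma function_space_simps [simp]:
  "carrier function_space = UNIV" "zero function_space = (\<lambda>_. 0)"
  "add function_space = (\<lambda>f h x. f x + h x)" "smult function_space = (\<lambda>r f x. r * f x)"
  by (simp_all add: function_space_def)

lemma function_space_vectorspace: "vectorspace real_field (function_space :: (real, 'a \<Rightarrow> real) module)"
  (is "vectorspace _ ?F")
proof (rule vs_criteria)
  show "\<forall>v\<in>carrier ?F. \<exists>neg_v\<in>carrier ?F. v \<oplus>\<^bsub>?F\<^esub> neg_v = \<zero>\<^bsub>?F\<^esub>"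
  proof
    fix v :: "'a \<Rightarrow> real"
    show "\<exists>neg_v\<in>carrier ?F. v \<oplus>\<^bsub>?F\<^esub> neg_v = \<zero>\<^bsub>?F\<^esub>"
      by (intro bexI[of _ "\<lambda>x. - v x"]) auto
  qed
qed (auto simp: class_field algebra_simps)

interpretation FS: real_vectorspace function_space
  by (rule real_vectorspaceI[OF function_space_vectorspace])

lemma function_subspaceI:
  assumes "(\<lambda>_. 0) \<in> W" and "\<And>f h. f \<in> W \<Longrightarrow> h \<in> W \<Longrightarrow> (\<lambda>x. f x + h x) \<in> W"
    and "\<And>r f. f \<in> W \<Longrightarrow> (\<lambda>x. r * f x) \<in> W"
  shows "submodule real_field W function_space"
  using assms FS.module_axioms by (simp add: submodule_def)

lemma function_subspace_sum:
  assumes "submodule real_field W function_space" and "finite A" and "\<And>a. a \<in> A \<Longrightarrow> f a \<in> W"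
  shows "(\<lambda>x. \<Sum>a\<in>A. c a * f a x) \<in> W"
  using assms(2,3)
proof (induction A rule: finite_induct)
  case empty
  then show ?case using submodule.zero_closed[OF assms(1)] by simp
next
  case (insert a A)
  have "(\<lambda>x. c a * f a x) \<in> W" using submodule.smult_closed[OF assms(1), of "c a" "f a"] insert by simp
  then show ?case using submodule.m_closed[OF assms(1)] insert by fastforce
qed

section \<open>Alternating forms\<close>

lemma cochains_eq: "cochains V k = function_space\<lparr>carrier := alternating_forms V k\<rparr>"
  by (simp add: cochains_def function_space_def)

lemma alternating_formsI:
  assumes "\<And>xs. \<not> (length xs = k \<and> set xs \<subseteq> carrier V) \<Longrightarrow> \<omega> xs = 0"
    and "\<And>xs i x y. length xs = k \<Longrightarrow> set xs \<subseteq> carrier V \<Longrightarrow> i < k \<Longrightarrow> x \<in> carrier V \<Longrightarrow> y \<in> carrier V \<Longrightarrow>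
      \<omega> (xs[i := x \<oplus>\<^bsub>V\<^esub> y]) = \<omega> (xs[i := x]) + \<omega> (xs[i := y])"
    and "\<And>xs i r x. length xs = k \<Longrightarrow> set xs \<subseteq> carrier V \<Longrightarrow> i < k \<Longrightarrow> x \<in> carrier V \<Longrightarrow>
      \<omega> (xs[i := r \<odot>\<^bsub>V\<^esub> x]) = r * \<omega> (xs[i := x])"
    and "\<And>xs i j. length xs = k \<Longrightarrow> set xs \<subseteq> carrier V \<Longrightarrow> i < k \<Longrightarrow> j < k \<Longrightarrow> i \<noteq> j \<Longrightarrow> xs ! i = xs ! j \<Longrightarrow>
      \<omega> xs = 0"
  shows "\<omega> \<in> alternating_forms V k"
  unfolding alternating_forms_def mem_Collect_eq
  by (intro conjI allI impI ballI; (elim conjE)?; rule assms; assumption)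

context
  fixes \<omega> V k assumes \<omega>: "\<omega> \<in> alternating_forms V k"
begin

lemma alternating_forms_eq_0: "\<not> (length xs = k \<and> set xs \<subseteq> carrier V) \<Longrightarrow> \<omega> xs = 0"
  using \<omega> unfolding alternating_forms_def by blast

lemma alternating_forms_add:
  "length xs = k \<Longrightarrow> set xs \<subseteq> carrier V \<Longrightarrow> i < k \<Longrightarrow> x \<in> carrier V \<Longrightarrow> y \<in> carrier V \<Longrightarrow>
    \<omega> (xs[i := x \<oplus>\<^bsub>V\<^esub> y]) = \<omega> (xs[i := x]) + \<omega> (xs[i := y])"
  using \<omega> unfolding alternating_forms_def by blast

lemma alternating_forms_smult:
  "length xs = k \<Longrightarrow> set xs \<subseteq> carrier V \<Longrightarrow> i < k \<Longrightarrow> x \<in> carrier V \<Longrightarrow>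
    \<omega> (xs[i := r \<odot>\<^bsub>V\<^esub> x]) = r * \<omega> (xs[i := x])"
  using \<omega> unfolding alternating_forms_def by blast

lemma alternating_forms_repeated:
  assumes "\<not> distinct xs"
  shows "\<omega> xs = 0"
proof (cases "length xs = k \<and> set xs \<subseteq> carrier V")
  case True
  with assms obtain i j where "i < k" "j < k" "i \<noteq> j" "xs ! i = xs ! j"
    by (auto simp: distinct_conv_nth)
  with True \<omega> show ?thesis unfolding alternating_forms_def by blast
qed (rule alternating_forms_eq_0)

end

lemma alternating_forms_subspace: "submodule real_field (alternating_forms V k) function_space"
proof (rule function_subspaceI)
  show "(\<lambda>_. 0) \<in> alternating_forms V k" by (rule alternating_formsI) simp_all
  show "(\<lambda>xs. f xs + h xs) \<in> alternating_forms V k"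
    if f: "f \<in> alternating_forms V k" and h: "h \<in> alternating_forms V k" for f h
  proof (rule alternating_formsI)
    show "f xs + h xs = 0" if "length xs = k" "i < k" "j < k" "i \<noteq> j" "xs ! i = xs ! j" for xs i j
    proof -
      have "\<not> distinct xs" using that by (auto simp: distinct_conv_nth)
      then show ?thesis by (simp add: alternating_forms_repeated[OF f] alternating_forms_repeated[OF h])
    qed
  qed (simp_all add: alternating_forms_eq_0[OF f] alternating_forms_eq_0[OF h]
      alternating_forms_add[OF f] alternating_forms_add[OF h]
      alternating_forms_smult[OF f] alternating_forms_smult[OF h] distrib_left)
  show "(\<lambda>xs. r * f xs) \<in> alternating_forms V k" if f: "f \<in> alternating_forms V k" for r f
  proof (rule alternating_formsI)
    show "r * f xs = 0" if "length xs = k" "i < k" "j < k" "i \<noteq> j" "xs ! i = xs ! j" for xs i j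
    proof -
      have "\<not> distinct xs" using that by (auto simp: distinct_conv_nth)
      then show ?thesis by (simp add: alternating_forms_repeated[OF f])
    qed
  qed (simp_all add: alternating_forms_eq_0[OF f] alternating_forms_add[OF f]
      alternating_forms_smult[OF f] distrib_left)
qed

text \<open>The slot is marked by splitting the argument list, the shape in which bracket terms and
  expansions along a basis produce arguments.\<close>

lemma alternating_forms_slot_linear:
  assumes \<omega>: "\<omega> \<in> alternating_forms V k"
    and "length us + length vs + 1 = k" and "set us \<subseteq> carrier V" and "set vs \<subseteq> carrier V"
  shows "linear_functional V (\<lambda>x. \<omega> (us @ x # vs))"
proof -
  have upd: "(us @ x # vs)[length us := y] = us @ y # vs" for x y by simp
  have len: "length us < k" using assms(2) by simp
  have "\<omega> (us @ (x \<oplus>\<^bsub>V\<^esub> y) # vs) = \<omega> (us @ x # vs) + \<omega> (us @ y # vs)"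
    "\<omega> (us @ (r \<odot>\<^bsub>V\<^esub> x) # vs) = r * \<omega> (us @ x # vs)"
    if "x \<in> carrier V" "y \<in> carrier V" for x y r
    using alternating_forms_add[OF \<omega>, of "us @ x # vs" "length us" x y]
      alternating_forms_smult[OF \<omega>, of "us @ x # vs" "length us" x r] that assms(2-4) len
    by (simp_all add: upd)
  then show ?thesis unfolding linear_functional_def by blast
qed

context real_vectorspace
begin

text \<open>Multilinear expansion, one slot at a time: all arguments to the left of the current slot are
  arbitrary vectors, all arguments to the right of it are basis vectors.\<close>

lemma form_eq_0_if_vanishes_on_basis:
  assumes \<omega>: "\<omega> \<in> alternating_forms V k"
    and db: "dual_basis V n e \<psi>"
    and van: "\<And>ts. length ts = k \<Longrightarrow> set ts \<subseteq> {..<n} \<Longrightarrow> \<omega> (map e ts) = 0"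
  shows "\<omega> = (\<lambda>_. 0)"
proof
  fix xs
  have "\<omega> (ys @ map e ts) = 0"
    if "length ys + length ts = k" "set ys \<subseteq> carrier V" "set ts \<subseteq> {..<n}" for ys ts
    using that
  proof (induction ys arbitrary: ts rule: rev_induct)
    case Nil
    then show ?case using van by simp
  next
    case (snoc y ys)
    have "set (map e ts) \<subseteq> carrier V" using snoc.prems dual_basis_mem[OF db] by auto
    then have "linear_functional V (\<lambda>x. \<omega> (ys @ x # map e ts))"
      using snoc.prems by (intro alternating_forms_slot_linear[OF \<omega>]) auto
    from dual_basis_expand[OF db this, of y] have
      "\<omega> (ys @ y # map e ts) = (\<Sum>i<n. \<psi> i y * \<omega> (ys @ e i # map e ts))"
      using snoc.prems by simp
    also have "\<dots> = (\<Sum>i<n. 0)"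
    proof (rule sum.cong)
      fix i assume "i \<in> {..<n}"
      then show "\<psi> i y * \<omega> (ys @ e i # map e ts) = 0"
        using snoc.IH[of "i # ts"] snoc.prems by simp
    qed simp
    finally show ?case by simp
  qed
  from this[of xs "[]"] show "\<omega> xs = 0"
    using alternating_forms_eq_0[OF \<omega>, of xs] by (cases "length xs = k \<and> set xs \<subseteq> carrier V") auto
qed

lemma alternating_forms_above_dim:
  assumes "fin_dim" and "dim < k" and \<omega>: "\<omega> \<in> alternating_forms V k"
  shows "\<omega> = (\<lambda>_. 0)"
proof -
  obtain e \<psi> where db: "dual_basis V dim e \<psi>" using dual_basis_exists[OF assms(1)] .
  show ?thesis
  proof (rule form_eq_0_if_vanishes_on_basis[OF \<omega> db])
    fix ts assume ts: "length ts = k" "set ts \<subseteq> {..<dim}"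
    have "card (set ts) \<le> dim" using card_mono[OF _ ts(2)] by simp
    then have "\<not> distinct ts" using ts(1) assms(2) distinct_card[of ts] by auto
    then show "\<omega> (map e ts) = 0"
      using alternating_forms_repeated[OF \<omega>, of "map e ts"] by (simp add: distinct_map)
  qed
qed

lemma cochains_vectorspace: "vectorspace real_field (cochains V k)"
  unfolding cochains_eq
  by (rule submodule_real_vectorspace[OF function_space_vectorspace alternating_forms_subspace])

text \<open>The values on tuples of basis vectors separate forms, and there are finitely many such tuples.\<close>

lemma cochains_fin_dim:
  assumes "fin_dim"
  shows "vectorspace.fin_dim real_field (cochains V k)"
proof -
  obtain e \<psi> where db: "dual_basis V dim e \<psi>" using dual_basis_exists[OF assms] .
  interpret C: real_vectorspace "cochains V k" by (rule real_vectorspaceI[OF cochains_vectorspace])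
  show ?thesis
  proof (rule C.fin_dim_if_separating)
    show "finite {ts. set ts \<subseteq> {..<dim} \<and> length ts = k}" by (rule finite_lists_length_eq) simp
    show "linear_functional (cochains V k) (\<lambda>\<omega>. \<omega> (map e ts))" for ts
      by (simp add: linear_functional_def cochains_def)
    show "\<omega> = \<zero>\<^bsub>cochains V k\<^esub>" if "\<omega> \<in> carrier (cochains V k)"
      "\<And>ts. ts \<in> {ts. set ts \<subseteq> {..<dim} \<and> length ts = k} \<Longrightarrow> \<omega> (map e ts) = 0" for \<omega>
      using form_eq_0_if_vanishes_on_basis[OF _ db, of \<omega> k] that
      by (simp add: cochains_def)
  qed
qed

lemma alternating_forms_head_zero:
  assumes \<omega>: "\<omega> \<in> alternating_forms V k"
  shows "\<omega> (\<zero>\<^bsub>V\<^esub> # ys) = 0"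
proof (cases "length ys + 1 = k \<and> set ys \<subseteq> carrier V")
  case True
  then show ?thesis
    using functional_zero[OF alternating_forms_slot_linear[OF \<omega>, of "[]" ys]] by simp
next
  case False
  then show ?thesis by (intro alternating_forms_eq_0[OF \<omega>]) auto
qed

end

text \<open>This is the exterior product \<open>\<psi> t\<^sub>1 \<and> \<dots> \<and> \<psi> t\<^sub>k\<close> of functionals.\<close>

definition det_form ::
  "(real, 'a, 'm) module_scheme \<Rightarrow> (nat \<Rightarrow> 'a \<Rightarrow> real) \<Rightarrow> nat list \<Rightarrow> 'a list \<Rightarrow> real" where
  "det_form V \<psi> ts xs =
     (if length xs = length ts \<and> set xs \<subseteq> carrier V
      then det (mat (length ts) (length ts) (\<lambda>(i, j). \<psi> (ts ! j) (xs ! i))) else 0)"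

text \<open>Linearity in slot \<open>i\<close> comes from the Laplace expansion along row \<open>i\<close>, whose cofactors do not involve
  that row; equal arguments give equal rows.\<close>

lemma det_form_alternating:
  assumes V: "real_vectorspace V" and \<psi>: "\<And>t. t \<in> set ts \<Longrightarrow> linear_functional V (\<psi> t)"
  shows "det_form V \<psi> ts \<in> alternating_forms V (length ts)"
proof -
  interpret real_vectorspace V by (rule V)
  define k where "k = length ts"
  define A where "A xs = mat k k (\<lambda>(i, j). \<psi> (ts ! j) (xs ! i))" for xs
  have A: "A xs \<in> carrier_mat k k" for xs by (simp add: A_def)
  have row_expand: "det_form V \<psi> ts (xs[i := x]) = (\<Sum>j<k. \<psi> (ts ! j) x * cofactor (A xs) i j)"
    if "length xs = k" "set xs \<subseteq> carrier V" "i < k" "x \<in> carrier V" for xs i x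
  proof -
    have "set (xs[i := x]) \<subseteq> carrier V" using that set_update_subset_insert[of xs i x] by blast
    then have "det_form V \<psi> ts (xs[i := x]) = det (A (xs[i := x]))"
      using that by (simp add: det_form_def A_def k_def)
    also have "\<dots> = (\<Sum>j<k. A (xs[i := x]) $$ (i, j) * cofactor (A (xs[i := x])) i j)"
      by (rule laplace_expansion_row[OF A that(3)])
    also have "\<dots> = (\<Sum>j<k. \<psi> (ts ! j) x * cofactor (A xs) i j)"
    proof (rule sum.cong)
      fix j assume "j \<in> {..<k}"
      moreover have "mat_delete (A (xs[i := x])) i j = mat_delete (A xs) i j"
        unfolding mat_delete_def A_def by (rule eq_matI) auto
      ultimately show "A (xs[i := x]) $$ (i, j) * cofactor (A (xs[i := x])) i j =
          \<psi> (ts ! j) x * cofactor (A xs) i j"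
        using that by (simp add: cofactor_def A_def)
    qed simp
    finally show ?thesis .
  qed
  have lin: "\<psi> (ts ! j) (x \<oplus>\<^bsub>V\<^esub> y) = \<psi> (ts ! j) x + \<psi> (ts ! j) y"
    "\<psi> (ts ! j) (r \<odot>\<^bsub>V\<^esub> x) = r * \<psi> (ts ! j) x"
    if "j < k" "x \<in> carrier V" "y \<in> carrier V" for j x y r
    using \<psi>[of "ts ! j"] that by (auto simp: linear_functional_def k_def)
  show ?thesis
    unfolding k_def[symmetric]
  proof (rule alternating_formsI)
    show "det_form V \<psi> ts xs = 0"
      if "length xs = k" "set xs \<subseteq> carrier V" "i < k" "j < k" "i \<noteq> j" "xs ! i = xs ! j" for xs i j
    proof -
      have "det (A xs) = 0"
        by (rule det_identical_rows[OF A that(5,3,4)], rule eq_vecI) (use that in \<open>auto simp: A_def\<close>)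
      then show ?thesis using that by (simp add: det_form_def A_def k_def)
    qed
    show "det_form V \<psi> ts xs = 0" if "\<not> (length xs = k \<and> set xs \<subseteq> carrier V)" for xs
      using that by (auto simp: det_form_def k_def)
    show "det_form V \<psi> ts (xs[i := x \<oplus>\<^bsub>V\<^esub> y]) =
        det_form V \<psi> ts (xs[i := x]) + det_form V \<psi> ts (xs[i := y])"
      if "length xs = k" "set xs \<subseteq> carrier V" "i < k" "x \<in> carrier V" "y \<in> carrier V" for xs i x y
      using that by (simp add: row_expand lin distrib_right sum.distrib)
    show "det_form V \<psi> ts (xs[i := r \<odot>\<^bsub>V\<^esub> x]) = r * det_form V \<psi> ts (xs[i := x])"
      if "length xs = k" "set xs \<subseteq> carrier V" "i < k" "x \<in> carrier V" for xs i x r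
    proof -
      have "r \<odot>\<^bsub>V\<^esub> x \<in> carrier V" by (rule smult_closed[OF real_field_mem that(4)])
      then show ?thesis using that by (simp add: row_expand lin[OF _ that(4,4)] sum_distrib_left mult.assoc)
    qed
  qed
qed

text \<open>If \<open>S\<close> and \<open>T\<close> differ but have equally many elements, then some element of \<open>S\<close> is missing from \<open>T\<close> and
  its row vanishes. The determinant forms thus have any prescribed values on increasing tuples of basis
  vectors.\<close>

lemma det_form_dual:
  assumes db: "dual_basis V n e \<psi>"
    and S: "S \<subseteq> {..<n}" and T: "T \<subseteq> {..<n}" and card: "card S = card T"
  shows "det_form V \<psi> (sorted_list_of_set T) (map e (sorted_list_of_set S)) = (if S = T then 1 else 0)"
proof -
  define ts ss k where "ts = sorted_list_of_set T" and "ss = sorted_list_of_set S" and "k = card T"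
  have fin: "finite S" "finite T" using S T finite_subset by blast+
  have len: "length ts = k" "length ss = k" and sets: "set ts = T" "set ss = S" "distinct ts"
    using fin card by (simp_all add: ts_def ss_def k_def)
  define A :: "real mat" where "A = mat k k (\<lambda>(i, j). if ts ! j = ss ! i then 1 else 0)"
  have bound: "ts ! i < n" "ss ! i < n" if "i < k" for i
    using nth_mem[of i ts] nth_mem[of i ss] that len sets S T by auto
  have "mat k k (\<lambda>(i, j). \<psi> (ts ! j) (map e ss ! i)) = A"
    unfolding A_def by (rule eq_matI) (auto simp: dual_basis_eval[OF db] bound len)
  moreover have "set (map e ss) \<subseteq> carrier V" using sets S dual_basis_mem[OF db] by auto
  ultimately have "det_form V \<psi> ts (map e ss) = det A"
    using len by (simp add: det_form_def)
  also have "det A = (if S = T then 1 else 0)"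
  proof (cases "S = T")
    case True
    then have "A = 1\<^sub>m k"
      unfolding A_def by (intro eq_matI) (use sets len in \<open>auto simp: ts_def ss_def nth_eq_iff_index_eq\<close>)
    then show ?thesis using True by simp
  next
    case False
    then have "\<not> S \<subseteq> T" using card_subset_eq[OF fin(2)] card by metis
    then obtain i where i: "i < k" "ss ! i \<notin> T"
      using sets(2) len by (metis in_set_conv_nth subsetI)
    then have "A $$ (i, j) = 0" if "j < k" for j
      using that sets len nth_mem[of j ts] unfolding A_def by auto
    moreover have "A \<in> carrier_mat k k" by (simp add: A_def)
    ultimately show ?thesis using laplace_expansion_row[of A k i] i False by simp
  qed
  finally show ?thesis by (simp add: ts_def ss_def)
qed

section \<open>Basic cohomology\<close>

lemma linear_mapI:
  assumes "vectorspace real_field V" and "vectorspace real_field W"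
    and "\<And>x. x \<in> carrier V \<Longrightarrow> T x \<in> carrier W"
    and "\<And>x y. x \<in> carrier V \<Longrightarrow> y \<in> carrier V \<Longrightarrow> T (x \<oplus>\<^bsub>V\<^esub> y) = T x \<oplus>\<^bsub>W\<^esub> T y"
    and "\<And>r x. x \<in> carrier V \<Longrightarrow> T (r \<odot>\<^bsub>V\<^esub> x) = r \<odot>\<^bsub>W\<^esub> T x"
  shows "linear_map real_field V W T"
proof -
  have "T \<in> LinearCombinations.module_hom real_field V W"
    using assms(3-5) by (auto simp: LinearCombinations.module_hom_def)
  moreover have "module real_field V" "module real_field W"
    using assms(1,2) by (simp_all add: vectorspace_def)
  ultimately show ?thesis
    using assms(1,2) unfolding linear_map_def mod_hom_def mod_hom_axioms_def by blast
qed

lemma linear_map_onto_image: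
  assumes "linear_map real_field V W T"
  shows "linear_map real_field V (W\<lparr>carrier := T ` carrier V\<rparr>) T"
proof -
  interpret T: linear_map real_field V W T by (rule assms)
  have "vectorspace real_field (W\<lparr>carrier := T ` carrier V\<rparr>)"
    using T.W.subspace_is_vs[OF T.imT_is_subspace] by (simp add: T.im_def)
  then show ?thesis
    using T.V.vectorspace_axioms T.T_add T.T_smult by (intro linear_mapI) auto
qed

lemma ce_differential_add:
  "ce_differential g (\<lambda>xs. f xs + h xs) = (\<lambda>xs. ce_differential g f xs + ce_differential g h xs)"
  by (intro ext) (simp add: ce_differential_def distrib_left sum.distrib sum_subtractf sum_negf)

lemma ce_differential_smult:
  "ce_differential g (\<lambda>xs. r * f xs) = (\<lambda>xs. r * ce_differential g f xs)"
  by (intro ext) (simp add: ce_differential_def sum_distrib_left mult.left_commute)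

lemma ce_differential_zero: "ce_differential g (\<lambda>_. 0) = (\<lambda>_. 0)"
  by (simp add: ce_differential_def fun_eq_iff)

lemma coboundaries_subspace: "submodule real_field (coboundaries g k) function_space"
proof (cases k)
  case 0
  then show ?thesis by (intro function_subspaceI) (simp_all add: coboundaries_def)
next
  case (Suc j)
  then have B: "coboundaries g k = ce_differential g ` alternating_forms g j"
    by (simp add: coboundaries_def)
  note alt = submodule.zero_closed[OF alternating_forms_subspace, simplified]
    submodule.m_closed[OF alternating_forms_subspace, simplified]
    submodule.smult_closed[OF alternating_forms_subspace, simplified]
  show ?thesis
    unfolding B
  proof (rule function_subspaceI)
    show "(\<lambda>_. 0) \<in> ce_differential g ` alternating_forms g j"
      by (rule image_eqI[where x = "\<lambda>_. 0"]) (simp_all add: ce_differential_zero alt(1))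
    show "(\<lambda>xs. f xs + h xs) \<in> ce_differential g ` alternating_forms g j"
      if fh: "f \<in> ce_differential g ` alternating_forms g j" "h \<in> ce_differential g ` alternating_forms g j" for f h
    proof -
      obtain f' h' where "f' \<in> alternating_forms g j" "h' \<in> alternating_forms g j"
        "f = ce_differential g f'" "h = ce_differential g h'"
        using fh by blast
      then show ?thesis
        by (intro image_eqI[of _ _ "\<lambda>xs. f' xs + h' xs"]) (simp_all add: ce_differential_add alt(2))
    qed
    show "(\<lambda>xs. r * f xs) \<in> ce_differential g ` alternating_forms g j"
      if fh: "f \<in> ce_differential g ` alternating_forms g j" for r f
    proof -
      obtain f' where "f' \<in> alternating_forms g j" "f = ce_differential g f'"
        using fh by blast
      then show ?thesis
        by (intro image_eqI[of _ _ "\<lambda>xs. r * f' xs"]) (simp_all add: ce_differential_smult alt(3))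
    qed
  qed
qed

lemma cocycles_subspace: "submodule real_field (cocycles g k) function_space"
proof -
  note alt = submodule.zero_closed[OF alternating_forms_subspace, simplified]
    submodule.m_closed[OF alternating_forms_subspace, simplified]
    submodule.smult_closed[OF alternating_forms_subspace, simplified]
  show ?thesis
    by (rule function_subspaceI)
      (auto simp: cocycles_def alt ce_differential_zero ce_differential_add ce_differential_smult)
qed

abbreviation cohomology_class ::
  "('a, 'm) lie_algebra_scheme \<Rightarrow> nat \<Rightarrow> ('a list \<Rightarrow> real) \<Rightarrow> ('a list \<Rightarrow> real) set" where
  "cohomology_class g k \<omega> \<equiv> coboundaries g k +>\<^bsub>function_space\<^esub> \<omega>"

lemma coset_cochains: "B +>\<^bsub>cochains g k\<lparr>carrier := Z\<rparr>\<^esub> \<omega> = B +>\<^bsub>function_space\<^esub> \<omega>"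
  "B +>\<^bsub>cochains g k\<^esub> \<omega> = B +>\<^bsub>function_space\<^esub> \<omega>"
  by (simp_all add: a_r_coset_def' cochains_def)

lemma cohomology_eq:
  "cohomology g k = (quotient_space function_space (coboundaries g k))
     \<lparr>carrier := cohomology_class g k ` cocycles g k\<rparr>"
proof -
  have "set_add (cochains g k\<lparr>carrier := cocycles g k\<rparr>) = set_add function_space"
    by (intro ext) (simp add: set_add_def' cochains_def)
  moreover have "a_rcosets\<^bsub>cochains g k\<lparr>carrier := cocycles g k\<rparr>\<^esub> (coboundaries g k) =
      cohomology_class g k ` cocycles g k"
    unfolding A_RCOSETS_def' coset_cochains by auto
  moreover have "smult (cochains g k) = smult function_space"
    by (simp add: cochains_def)
  ultimately show ?thesis
    by (simp add: cohomology_def quotient_space_def coset_cochains)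
qed

lemma zero_coset: "{\<lambda>_. 0} +>\<^bsub>function_space\<^esub> \<omega> = {\<omega>}"
  by (simp add: a_r_coset_def')

lemma abelianization_simps:
  "carrier (abelianization g) = carrier (quotient_space g (derived_algebra g))"
  "add (abelianization g) = add (quotient_space g (derived_algebra g))"
  "smult (abelianization g) = smult (quotient_space g (derived_algebra g))"
  "lie_bracket (abelianization g) X Y = (\<Union>x\<in>X. \<Union>y\<in>Y. derived_algebra g +>\<^bsub>g\<^esub> \<lbrakk>x, y\<rbrakk>\<^bsub>g\<^esub>)"
  by (simp_all add: abelianization_def quotient_lie_algebra_def module.defs lie_algebra.defs)

lemma alternating_forms_abelianization:
  "alternating_forms (abelianization g) k = alternating_forms (quotient_space g (derived_algebra g)) k"
  by (simp add: alternating_forms_def abelianization_simps)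

context two_step_nilpotent_lie_algebra
begin

sublocale real_vectorspace g
  by unfold_locales

abbreviation Q where "Q \<equiv> quotient_space g (derived_algebra g)"

abbreviation basic_form where "basic_form \<equiv> pullback_form g (abelianization_map g)"

lemma brackets_subset: "{\<lbrakk>x, y\<rbrakk> |x y. x \<in> carrier g \<and> y \<in> carrier g} \<subseteq> carrier g"
  using bracket_closed by blast

lemma derived_subspace: "submodule real_field (derived_algebra g) g"
  unfolding derived_algebra_def by (rule span_is_submodule[OF brackets_subset])

lemma bracket_in_derived: "x \<in> carrier g \<Longrightarrow> y \<in> carrier g \<Longrightarrow> \<lbrakk>x, y\<rbrakk> \<in> derived_algebra g"
  unfolding derived_algebra_def using in_own_span[OF brackets_subset] by blast

lemma derived_subset: "derived_algebra g \<subseteq> carrier g"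
  by (rule submodule.subset[OF derived_subspace])

lemma Q_vectorspace: "real_vectorspace Q"
  by (rule real_vectorspaceI[OF quotient_vectorspace[OF derived_subspace]])

lemma abelianization_bracket:
  assumes "X \<in> carrier (abelianization g)" and "Y \<in> carrier (abelianization g)"
  shows "\<lbrakk>X, Y\<rbrakk>\<^bsub>abelianization g\<^esub> = derived_algebra g"
proof -
  interpret D: abelian_subgroup "derived_algebra g" g
    by (rule subspace_additive_subgroup[OF derived_subspace])
  obtain x0 y0 where x0: "x0 \<in> carrier g" "X = derived_algebra g +> x0"
    and y0: "y0 \<in> carrier g" "Y = derived_algebra g +> y0"
    using assms by (auto simp: abelianization_simps quotient_carrier[OF derived_subspace])
  have sub: "X \<subseteq> carrier g" "Y \<subseteq> carrier g"
    using a_r_coset_subset_G[OF derived_subset] x0 y0 by auto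
  have mem: "x0 \<in> X" "y0 \<in> Y" using D.a_rcos_self x0 y0 by auto
  have one: "derived_algebra g +> \<lbrakk>x, y\<rbrakk> = derived_algebra g" if "x \<in> X" "y \<in> Y" for x y
  proof -
    have "x \<in> carrier g" "y \<in> carrier g" using sub that by auto
    then show ?thesis
      using coset_eq_iff_mem[OF derived_subspace bracket_closed] bracket_in_derived by blast
  qed
  have "(\<Union>x\<in>X. \<Union>y\<in>Y. derived_algebra g +> \<lbrakk>x, y\<rbrakk>) = (\<Union>x\<in>X. \<Union>y\<in>Y. derived_algebra g)"
    using one by (intro SUP_cong refl) auto
  also have "\<dots> = derived_algebra g" using mem by auto
  finally show ?thesis by (simp add: abelianization_simps)
qed

text \<open>All brackets of the quotient are zero, so each term of the differential has a zero argument.\<close>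

lemma abelianization_differential:
  assumes \<omega>: "\<omega> \<in> alternating_forms Q k"
  shows "ce_differential (abelianization g) \<omega> = (\<lambda>_. 0)"
proof
  fix xs
  interpret Q: real_vectorspace Q by (rule Q_vectorspace)
  show "ce_differential (abelianization g) \<omega> xs = 0"
  proof (cases "set xs \<subseteq> carrier (abelianization g)")
    case True
    have "\<omega> (\<lbrakk>xs ! i, xs ! j\<rbrakk>\<^bsub>abelianization g\<^esub> # ys) = 0" if "j < length xs" "i < j" for i j ys
    proof -
      have "xs ! i \<in> set xs" "xs ! j \<in> set xs" using that by auto
      then have "\<lbrakk>xs ! i, xs ! j\<rbrakk>\<^bsub>abelianization g\<^esub> = \<zero>\<^bsub>Q\<^esub>"
        using abelianization_bracket[OF subsetD[OF True] subsetD[OF True]]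
        by (simp add: quotient_zero[OF derived_subspace])
      then show ?thesis using Q.alternating_forms_head_zero[OF \<omega>] by simp
    qed
    then show ?thesis by (simp add: ce_differential_def)
  qed (simp add: ce_differential_def)
qed

lemma abelianization_cohomology_carrier:
  "carrier (cohomology (abelianization g) k) = (\<lambda>\<omega>. {\<omega>}) ` alternating_forms Q k"
proof -
  have "cocycles (abelianization g) k = alternating_forms Q k"
    by (auto simp: cocycles_def alternating_forms_abelianization abelianization_differential)
  moreover have "coboundaries (abelianization g) k = {\<lambda>_. 0}"
  proof (cases k)
    case (Suc j)
    have "(\<lambda>_. 0) \<in> alternating_forms Q j"
      using submodule.zero_closed[OF alternating_forms_subspace, of Q j] by simp
    then show ?thesis
      by (auto simp: coboundaries_def Suc alternating_forms_abelianization abelianization_differential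
          intro!: image_eqI)
  qed (simp add: coboundaries_def)
  ultimately show ?thesis by (simp add: cohomology_eq zero_coset)
qed

lemma basic_cohomology_eq:
  "basic_cohomology g k = (quotient_space function_space (coboundaries g k))
     \<lparr>carrier := (\<lambda>\<omega>. cohomology_class g k (basic_form \<omega>)) ` alternating_forms Q k\<rparr>"
proof -
  have "cohomology_map g (abelianization_map g) k ` carrier (cohomology (abelianization g) k) =
      (\<lambda>\<omega>. cohomology_class g k (basic_form \<omega>)) ` alternating_forms Q k"
    unfolding abelianization_cohomology_carrier image_image cohomology_map_def coset_cochains by simp
  then show ?thesis
    unfolding basic_cohomology_def by (simp add: cohomology_eq[of g k])
qed

lemma basic_form_linear:
  "basic_form (\<lambda>xs. f xs + h xs) = (\<lambda>xs. basic_form f xs + basic_form h xs)"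
  "basic_form (\<lambda>xs. r * f xs) = (\<lambda>xs. r * basic_form f xs)"
  by (auto simp: pullback_form_def)

lemma Q_fin_dim: "fin_dim \<Longrightarrow> vectorspace.fin_dim real_field Q"
  by (rule linear_map.image_fin_dim[OF quotient_map_linear[OF derived_subspace]])
    (simp_all add: quotient_carrier[OF derived_subspace])

text \<open>Dimension is the least size of a finite generating set and says nothing about a space without one.
  Finite dimensionality is inherited from the forms on \<open>Q\<close>, of which basic cohomology is a linear image.\<close>

lemma basic_betti_number_eq_0_iff:
  assumes "fin_dim"
  shows "basic_betti_number g k = 0 \<longleftrightarrow>
    (\<forall>\<omega>\<in>alternating_forms Q k. basic_form \<omega> \<in> coboundaries g k)"
proof -
  interpret Q: real_vectorspace Q by (rule Q_vectorspace)
  let ?W = "quotient_space function_space (coboundaries g k)"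
  let ?T = "\<lambda>\<omega>. cohomology_class g k (basic_form \<omega>)"
  note quot = FS.quotient_add[OF coboundaries_subspace[of g k]] FS.quotient_smult[OF coboundaries_subspace[of g k]]
    FS.quotient_carrier[OF coboundaries_subspace[of g k]] FS.quotient_zero[OF coboundaries_subspace[of g k]]
  have "linear_map real_field (cochains Q k) ?W ?T"
  proof (rule linear_mapI[OF Q.cochains_vectorspace FS.quotient_vectorspace[OF coboundaries_subspace]])
    show "?T (x \<oplus>\<^bsub>cochains Q k\<^esub> y) = ?T x \<oplus>\<^bsub>?W\<^esub> ?T y" for x y
      using quot(1)[of "basic_form x" "basic_form y"] by (simp add: cochains_def basic_form_linear)
    show "?T (r \<odot>\<^bsub>cochains Q k\<^esub> x) = r \<odot>\<^bsub>?W\<^esub> ?T x" for r x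
      using quot(2)[of "basic_form x" r] by (simp add: cochains_def basic_form_linear)
    show "?T x \<in> carrier ?W" for x by (simp add: quot(3))
  qed
  from linear_map_onto_image[OF this]
  have lin: "linear_map real_field (cochains Q k) (basic_cohomology g k) ?T"
    by (simp add: basic_cohomology_eq cochains_def)
  interpret T: linear_map real_field "cochains Q k" "basic_cohomology g k" ?T by (rule lin)
  interpret B: real_vectorspace "basic_cohomology g k"
    by (rule real_vectorspaceI[OF T.W.vectorspace_axioms])
  have fd: "vectorspace.fin_dim real_field (basic_cohomology g k)"
    by (rule linear_map.image_fin_dim[OF lin Q.cochains_fin_dim[OF Q_fin_dim[OF assms]]])
      (simp add: basic_cohomology_eq cochains_def)
  have "basic_betti_number g k = 0 \<longleftrightarrow>
      ?T ` alternating_forms Q k = {coboundaries g k}"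
    unfolding basic_betti_number_def B.dim_eq_0_iff[OF fd]
    by (simp add: basic_cohomology_eq quot(4))
  also have "\<dots> \<longleftrightarrow> (\<forall>\<omega>\<in>alternating_forms Q k. ?T \<omega> = coboundaries g k)"
    using submodule.zero_closed[OF alternating_forms_subspace, of Q k] by blast
  also have "\<dots> \<longleftrightarrow> (\<forall>\<omega>\<in>alternating_forms Q k. basic_form \<omega> \<in> coboundaries g k)"
    using FS.coset_eq_iff_mem[OF coboundaries_subspace[of g k]] by simp
  finally show ?thesis .
qed

end

section \<open>Dimensions\<close>

context two_step_nilpotent_lie_algebra
begin

abbreviation codim where "codim \<equiv> vectorspace.dim real_field Q"

abbreviation derived_dim where
  "derived_dim \<equiv> vectorspace.dim real_field (g\<lparr>carrier := derived_algebra g\<rparr>)"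

lemma codim_plus_derived_dim:
  assumes "fin_dim"
  shows "codim + derived_dim = dim"
proof -
  interpret P: linear_map real_field g Q "\<lambda>x. derived_algebra g +> x"
    by (rule quotient_map_linear[OF derived_subspace])
  have "P.imT = carrier Q"
    by (simp add: P.im_def quotient_carrier[OF derived_subspace])
  then have im: "Q\<lparr>carrier := P.imT\<rparr> = Q" by simp
  have ker: "P.kerT = derived_algebra g"
    using derived_subset coset_eq_iff_mem[OF derived_subspace]
    by (auto simp: P.ker_def quotient_zero[OF derived_subspace])
  show ?thesis using P.rank_nullity[OF assms] unfolding im ker .
qed

lemma basic_form_alternating:
  assumes \<omega>: "\<omega> \<in> alternating_forms Q k"
  shows "basic_form \<omega> \<in> alternating_forms g k"
proof -
  let ?p = "abelianization_map g"
  have p: "?p x \<in> carrier Q" if "x \<in> carrier g" for x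
    using that by (simp add: abelianization_map_def quotient_carrier[OF derived_subspace])
  have map: "set (map ?p xs) \<subseteq> carrier Q" if "set xs \<subseteq> carrier g" for xs
    using p that by auto
  have upd: "set (xs[i := x]) \<subseteq> carrier g" if "set xs \<subseteq> carrier g" "x \<in> carrier g" for xs i x
    using that set_update_subset_insert[of xs i x] by blast
  show ?thesis
  proof (rule alternating_formsI)
    show "basic_form \<omega> xs = 0" if "\<not> (length xs = k \<and> set xs \<subseteq> carrier g)" for xs
      using that alternating_forms_eq_0[OF \<omega>, of "map ?p xs"] by (auto simp: pullback_form_def)
    show "basic_form \<omega> xs = 0" if "length xs = k" "i < k" "j < k" "i \<noteq> j" "xs ! i = xs ! j" for xs i j
    proof -
      have "\<not> distinct xs" using that by (auto simp: distinct_conv_nth)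
      then show ?thesis
        using alternating_forms_repeated[OF \<omega>, of "map ?p xs"] by (auto simp: pullback_form_def distinct_map)
    qed
    fix xs i x assume xs: "length xs = k" "set xs \<subseteq> carrier g" "i < k" "x \<in> carrier g"
    show "basic_form \<omega> (xs[i := x \<oplus> y]) = basic_form \<omega> (xs[i := x]) + basic_form \<omega> (xs[i := y])"
      if y: "y \<in> carrier g" for y
      using alternating_forms_add[OF \<omega> _ map[OF xs(2)] xs(3) p[OF xs(4)] p[OF y]] xs y upd
      by (simp add: pullback_form_def map_update abelianization_map_def quotient_add[OF derived_subspace])
    show "basic_form \<omega> (xs[i := r \<odot>\<^bsub>g\<^esub> x]) = r * basic_form \<omega> (xs[i := x])" for r
      using alternating_forms_smult[OF \<omega> _ map[OF xs(2)] xs(3) p[OF xs(4)], of r] xs upd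
        smult_closed[OF real_field_mem xs(4), of r]
      by (simp add: pullback_form_def map_update abelianization_map_def quotient_smult[OF derived_subspace])
  qed
qed

lemma basic_form_cocycle:
  assumes \<omega>: "\<omega> \<in> alternating_forms Q k"
  shows "basic_form \<omega> \<in> cocycles g k"
proof -
  interpret Q: real_vectorspace Q by (rule Q_vectorspace)
  have zero: "basic_form \<omega> (\<lbrakk>x, y\<rbrakk> # ys) = 0" if "x \<in> carrier g" "y \<in> carrier g" for x y ys
  proof -
    have "abelianization_map g \<lbrakk>x, y\<rbrakk> = \<zero>\<^bsub>Q\<^esub>"
      using coset_eq_iff_mem[OF derived_subspace bracket_closed[OF that]] bracket_in_derived[OF that]
      by (simp add: abelianization_map_def quotient_zero[OF derived_subspace])
    then show ?thesis using Q.alternating_forms_head_zero[OF \<omega>] by (simp add: pullback_form_def)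
  qed
  have "ce_differential g (basic_form \<omega>) xs = 0" for xs
  proof (cases "set xs \<subseteq> carrier g")
    case True
    then have "xs ! i \<in> carrier g" if "i < length xs" for i using that by (meson nth_mem subsetD)
    then show ?thesis by (simp add: ce_differential_def zero)
  qed (simp add: ce_differential_def)
  then show ?thesis using basic_form_alternating[OF \<omega>] by (auto simp: cocycles_def)
qed

text \<open>The differential of a one-form is its composition with the bracket, so the kernel of a one-cocycle
  is a subspace that contains all brackets.\<close>

lemma one_cocycle_kills_derived:
  assumes \<omega>: "\<omega> \<in> cocycles g 1" and w: "w \<in> derived_algebra g"
  shows "\<omega> [w] = 0"
proof -
  have alt: "\<omega> \<in> alternating_forms g 1" and d: "ce_differential g \<omega> = (\<lambda>_. 0)"
    using \<omega> by (auto simp: cocycles_def)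
  have lin: "linear_functional g (\<lambda>x. \<omega> [x])"
    using alternating_forms_slot_linear[OF alt, of "[]" "[]"] by simp
  let ?K = "{x \<in> carrier g. \<omega> [x] = 0}"
  have "submodule real_field ?K g"
  proof (rule submodule.intro)
    show "c \<odot>\<^bsub>g\<^esub> v \<in> ?K" if "v \<in> ?K" for c v
      using that lin smult_closed[OF real_field_mem, of v c] by (simp add: linear_functional_def)
  qed (use module_axioms functional_zero[OF lin] lin in \<open>auto simp: linear_functional_def\<close>)
  moreover have "{\<lbrakk>x, y\<rbrakk> |x y. x \<in> carrier g \<and> y \<in> carrier g} \<subseteq> ?K"
    using ce_differential_one_form[of _ g _ \<omega>] d bracket_closed by fastforce
  ultimately have "derived_algebra g \<subseteq> ?K"
    unfolding derived_algebra_def by (intro span_is_subset)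
  then show ?thesis using w by blast
qed

text \<open>Since it kills the derived algebra, a one-cocycle factors through \<open>Q\<close>, where it is determined
  by its values on a basis.\<close>

lemma one_cocycle_eq_0:
  assumes \<omega>: "\<omega> \<in> cocycles g 1" and db: "dual_basis Q n u \<psi>"
    and e: "\<And>i. i < n \<Longrightarrow> e i \<in> carrier g \<and> derived_algebra g +> e i = u i"
    and 0: "\<And>i. i < n \<Longrightarrow> \<omega> [e i] = 0"
  shows "\<omega> = (\<lambda>_. 0)"
proof
  fix xs
  interpret D: abelian_subgroup "derived_algebra g" g
    by (rule subspace_additive_subgroup[OF derived_subspace])
  have alt: "\<omega> \<in> alternating_forms g 1" using \<omega> by (simp add: cocycles_def)
  have lin: "linear_functional g (\<lambda>x. \<omega> [x])"
    using alternating_forms_slot_linear[OF alt, of "[]" "[]"] by simp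
  \<comment> \<open>the induced functional on \<open>Q\<close> is evaluated at an arbitrary representative of the coset\<close>
  define rep where "rep X = (SOME y. y \<in> X)" for X :: "'a set"
  have rep: "\<omega> [rep (derived_algebra g +> x)] = \<omega> [x]" if x: "x \<in> carrier g" for x
  proof -
    have "rep (derived_algebra g +> x) \<in> derived_algebra g +> x"
      unfolding rep_def using D.a_rcos_self[OF x] by (rule someI)
    then obtain w where w: "w \<in> derived_algebra g" "rep (derived_algebra g +> x) = w \<oplus> x"
      by (auto simp: a_r_coset_def')
    have "w \<in> carrier g" using w derived_subset by blast
    then show ?thesis
      using lin x one_cocycle_kills_derived[OF \<omega> w(1)] w(2) by (simp add: linear_functional_def)
  qed
  have linQ: "linear_functional Q (\<lambda>X. \<omega> [rep X])"
    unfolding linear_functional_def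
  proof (intro conjI ballI allI)
    fix X Y r assume X: "X \<in> carrier Q"
    then obtain x where x: "x \<in> carrier g" "X = derived_algebra g +> x"
      by (auto simp: quotient_carrier[OF derived_subspace])
    have "r \<odot>\<^bsub>g\<^esub> x \<in> carrier g" by (rule smult_closed[OF real_field_mem x(1)])
    then show "\<omega> [rep (r \<odot>\<^bsub>Q\<^esub> X)] = r * \<omega> [rep X]"
      using x lin by (simp add: quotient_smult[OF derived_subspace] rep linear_functional_def)
    assume "Y \<in> carrier Q"
    then obtain y where y: "y \<in> carrier g" "Y = derived_algebra g +> y"
      by (auto simp: quotient_carrier[OF derived_subspace])
    then show "\<omega> [rep (X \<oplus>\<^bsub>Q\<^esub> Y)] = \<omega> [rep X] + \<omega> [rep Y]"
      using x lin by (simp add: quotient_add[OF derived_subspace] rep linear_functional_def)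
  qed
  have "\<omega> [x] = 0" if x: "x \<in> carrier g" for x
  proof -
    have "derived_algebra g +> x \<in> carrier Q" using x by (simp add: quotient_carrier[OF derived_subspace])
    from dual_basis_expand[OF db linQ this]
    have "\<omega> [x] = (\<Sum>i<n. \<psi> i (derived_algebra g +> x) * \<omega> [rep (u i)])" by (simp add: rep[OF x])
    also have "\<dots> = (\<Sum>i<n. 0)"
      using e rep 0 by (intro sum.cong refl) (metis lessThan_iff mult_zero_right)
    finally show ?thesis by simp
  qed
  then show "\<omega> xs = 0"
    using alternating_forms_eq_0[OF alt, of xs]
    by (cases "length xs = 1 \<and> set xs \<subseteq> carrier g") (auto simp: length_Suc_conv)
qed

text \<open>The coordinate functionals of \<open>Q\<close>, pulled back, form a basis of the one-cocycles. In degree one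
  the only coboundary is zero, so a class is a single cocycle.\<close>

lemma betti_number_1:
  assumes "fin_dim"
  shows "betti_number g 1 = codim"
proof -
  interpret Q: real_vectorspace Q by (rule Q_vectorspace)
  let ?Z = "(function_space :: (real, 'a list \<Rightarrow> real) module)\<lparr>carrier := cocycles g 1\<rparr>"
  interpret Z: real_vectorspace ?Z
    by (rule real_vectorspaceI[OF submodule_real_vectorspace[OF function_space_vectorspace cocycles_subspace]])
  obtain u \<psi> where db: "dual_basis Q codim u \<psi>" using Q.dual_basis_exists[OF Q_fin_dim[OF assms]] .
  have "\<exists>x. x \<in> carrier g \<and> derived_algebra g +> x = u i" if "i < codim" for i
    using dual_basis_mem[OF db that] by (auto simp: quotient_carrier[OF derived_subspace])
  then obtain e where e: "\<And>i. i < codim \<Longrightarrow> e i \<in> carrier g \<and> derived_algebra g +> e i = u i" by metis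
  have dims: "vectorspace.fin_dim real_field ?Z" "vectorspace.dim real_field ?Z = codim"
  proof -
    have det: "det_form Q \<psi> [i] \<in> alternating_forms Q 1" if "i < codim" for i
      using det_form_alternating[OF Q_vectorspace, of "[i]" \<psi>] dual_basis_functional[OF db] that by simp
    have mem: "basic_form (det_form Q \<psi> [i]) \<in> carrier ?Z" if "i < codim" for i
      using basic_form_cocycle[OF det[OF that]] by simp
    have lin: "linear_functional ?Z (\<lambda>\<omega>. \<omega> [e i])" for i
      by (simp add: linear_functional_def)
    have dual: "basic_form (det_form Q \<psi> [j]) [e i] = (if i = j then 1 else 0)"
      if "i < codim" "j < codim" for i j
      using det_form_dual[OF db, of "{i}" "{j}"] that e[of i]
      by (simp add: pullback_form_def abelianization_map_def)
    have sep: "\<omega> = \<zero>\<^bsub>?Z\<^esub>" if "\<omega> \<in> carrier ?Z" "\<And>i. i < codim \<Longrightarrow> \<omega> [e i] = 0" for \<omega>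
      using one_cocycle_eq_0[OF _ db e] that by simp
    show "vectorspace.fin_dim real_field ?Z" "vectorspace.dim real_field ?Z = codim"
      using Z.dim_eqI_dual[OF mem lin dual sep] by blast+
  qed
  have B: "coboundaries g 1 = {\<lambda>_. 0}"
  proof -
    have "ce_differential g \<eta> = (\<lambda>_. 0)" if "\<eta> \<in> alternating_forms g 0" for \<eta>
      using alternating_forms_eq_0[OF that] by (simp add: ce_differential_def fun_eq_iff)
    moreover have "(\<lambda>_. 0) \<in> alternating_forms g 0"
      using submodule.zero_closed[OF alternating_forms_subspace, of g 0] by simp
    ultimately show ?thesis by (auto simp: coboundaries_def intro!: image_eqI)
  qed
  note quot = FS.quotient_add[OF coboundaries_subspace[of g 1]]
    FS.quotient_smult[OF coboundaries_subspace[of g 1]]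
    FS.quotient_carrier[OF coboundaries_subspace[of g 1]]
  have "linear_map real_field ?Z (quotient_space function_space (coboundaries g 1)) (cohomology_class g 1)"
    by (rule linear_mapI[OF Z.vectorspace_axioms FS.quotient_vectorspace[OF coboundaries_subspace]])
      (simp_all add: quot del: One_nat_def)
  from linear_map_onto_image[OF this]
  have lin: "linear_map real_field ?Z (cohomology g 1) (cohomology_class g 1)"
    by (simp add: cohomology_eq)
  have "inj_on (cohomology_class g 1) (carrier ?Z)"
    unfolding B zero_coset by (simp add: inj_on_def)
  moreover have "cohomology_class g 1 ` carrier ?Z = carrier (cohomology g 1)"
    by (simp add: cohomology_eq)
  ultimately have "vectorspace.dim real_field ?Z = vectorspace.dim real_field (cohomology g 1)"
    by (rule linear_map.dim_eq[OF lin dims(1)])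
  then show ?thesis unfolding betti_number_def dims(2) by (rule sym)
qed

end

section \<open>The dimension count\<close>

context two_step_nilpotent_lie_algebra
begin

text \<open>The values of a coboundary \<open>d \<eta>\<close> on increasing tuples of the lifts \<open>e i\<close> depend linearly on the values
  of \<open>\<eta>\<close> at one basis vector of the derived algebra followed by \<open>k - 1\<close> lifts. If there were fewer such
  parameters than tuples, some nonzero coefficient vector \<open>a\<close> would annihilate all coboundaries; but the form
  on \<open>Q\<close> with values \<open>a\<close> pulls back to a coboundary, and this gives \<open>\<Sum> a\<^sup>2 = 0\<close>.

  The sets \<open>S\<close> are described by \<open>Suc (card S) = k\<close> so that there are none for \<open>k = 0\<close>, where \<open>d \<eta>\<close>
  has no terms.\<close>

lemma vanishing_basic_cohomology_bound:
  assumes fd: "fin_dim"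
    and exact: "\<And>\<omega>. \<omega> \<in> alternating_forms Q (Suc k) \<Longrightarrow> basic_form \<omega> \<in> coboundaries g (Suc k)"
  shows "codim choose Suc k \<le> derived_dim * card {S. S \<subseteq> {..<codim} \<and> Suc (card S) = k}"
proof (rule ccontr)
  define n c where "n = codim" and "c = derived_dim"
  interpret Q: real_vectorspace Q by (rule Q_vectorspace)
  interpret D: real_vectorspace "g\<lparr>carrier := derived_algebra g\<rparr>"
    by (rule real_vectorspaceI[OF submodule_real_vectorspace[OF vectorspace_axioms derived_subspace]])
  obtain u \<psi> where db: "dual_basis Q n u \<psi>"
    unfolding n_def using Q.dual_basis_exists[OF Q_fin_dim[OF fd]] .
  have "\<exists>x. x \<in> carrier g \<and> derived_algebra g +> x = u i" if "i < n" for i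
    using dual_basis_mem[OF db that] by (auto simp: quotient_carrier[OF derived_subspace])
  then obtain e where e: "\<And>i. i < n \<Longrightarrow> e i \<in> carrier g \<and> derived_algebra g +> e i = u i" by metis
  obtain f \<gamma> where dbD: "dual_basis (g\<lparr>carrier := derived_algebra g\<rparr>) c f \<gamma>"
    unfolding c_def using D.dual_basis_exists[OF subspace_fin_dim[OF fd derived_subspace]] .
  define Ss where "Ss = {S. S \<subseteq> {..<n} \<and> Suc (card S) = k}"
  define Ts where "Ts = {T. T \<subseteq> {..<n} \<and> card T = Suc k}"
  define tup where "tup S = map e (sorted_list_of_set S)" for S
  define rest where "rest T i j = set (nths (sorted_list_of_set T) (- {i, j}))" for T :: "nat set" and i j
  \<comment> \<open>the coefficient of the parameter \<open>\<eta> (f l # tup S)\<close>, \<open>p = (l, S)\<close>, in the value of \<open>d \<eta>\<close> at \<open>tup T\<close>\<close>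
  define M where "M p T = (\<Sum>j<Suc k. \<Sum>i<j.
      if rest T i j = snd p then (-1) ^ (i + j + 1) * \<gamma> (fst p) \<lbrakk>tup T ! i, tup T ! j\<rbrakk> else 0)"
    for p :: "nat \<times> nat set" and T
  let ?N = "{..<c} \<times> Ss"
  have finSs: "finite Ss" and finTs: "finite Ts"
    unfolding Ss_def Ts_def by (auto intro: finite_subset[of _ "Pow {..<n}"])
  have tup_carrier: "set (tup S) \<subseteq> carrier g" if "S \<subseteq> {..<n}" for S
    using that e finite_subset[OF that] unfolding tup_def by auto

  have key: "ce_differential g \<eta> (tup T) = (\<Sum>p\<in>?N. M p T * \<eta> (f (fst p) # tup (snd p)))"
    if \<eta>: "\<eta> \<in> alternating_forms g k" and T: "T \<in> Ts" for \<eta> T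
  proof -
    define F where "F p j i = (if rest T i j = snd p
      then (-1) ^ (i + j + 1) * \<gamma> (fst p) \<lbrakk>tup T ! i, tup T ! j\<rbrakk> else 0)
        * \<eta> (f (fst p) # tup (snd p))" for p j i
    have TN: "T \<subseteq> {..<n}" "card T = Suc k" "finite T"
      using T finite_subset[of T "{..<n}"] by (auto simp: Ts_def)
    have len: "length (tup T) = Suc k" using TN by (simp add: tup_def)
    have summand: "(-1) ^ (i + j + 1) * \<eta> (\<lbrakk>tup T ! i, tup T ! j\<rbrakk> # nths (tup T) (- {i, j})) =
        (\<Sum>p\<in>?N. F p j i)" if ij: "i < j" "j < Suc k" for i j
    proof -
      let ?r = "rest T i j" and ?l = "nths (sorted_list_of_set T) (- {i, j})"
      have dist: "distinct ?l" by (simp add: distinct_nthsI)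
      \<comment> \<open>deleting two entries of an increasing tuple leaves an increasing tuple, so no sign arises from sorting\<close>
      have "sorted ?l" by (simp add: sorted_nths)
      then have tup_rest: "nths (tup T) (- {i, j}) = tup ?r"
        unfolding tup_def rest_def nths_map
        by (simp add: sorted_list_of_set.idem_if_sorted_distinct dist)
      have "length ?l = card {m. m < Suc k \<and> m \<in> - {i, j}}"
        using TN by (simp add: length_nths)
      also have "{m. m < Suc k \<and> m \<in> - {i, j}} = {..<Suc k} - {i, j}" by auto
      also have "card \<dots> = Suc k - 2" using ij by (subst card_Diff_subset) auto
      finally have "Suc (card ?r) = k"
        using ij distinct_card[OF dist] by (simp add: rest_def)
      moreover have "?r \<subseteq> {..<n}"
        using TN set_nths_subset[of "sorted_list_of_set T" "- {i, j}"] by (auto simp: rest_def)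
      ultimately have r: "?r \<in> Ss" by (simp add: Ss_def)
      have "tup T ! m \<in> carrier g" if "m < Suc k" for m
        using tup_carrier[OF TN(1)] nth_mem[of m "tup T"] len that by auto
      then have car: "tup T ! i \<in> carrier g" "tup T ! j \<in> carrier g" using ij by simp_all
      have "length (tup ?r) + 1 = k" using r finite_subset[of ?r "{..<n}"] by (simp add: Ss_def tup_def)
      then have "linear_functional g (\<lambda>x. \<eta> (x # tup ?r))"
        using alternating_forms_slot_linear[OF \<eta>, of "[]" "tup ?r"] tup_carrier[of ?r] r
        by (simp add: Ss_def)
      from dual_basis_expand[OF dbD linear_functional_subspace[OF this derived_subset]]
      have "\<eta> (\<lbrakk>tup T ! i, tup T ! j\<rbrakk> # tup ?r) =
          (\<Sum>l<c. \<gamma> l \<lbrakk>tup T ! i, tup T ! j\<rbrakk> * \<eta> (f l # tup ?r))"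
        using bracket_in_derived[OF car] by simp
      moreover have "(\<Sum>S\<in>Ss. F (l, S) j i) =
          (-1) ^ (i + j + 1) * (\<gamma> l \<lbrakk>tup T ! i, tup T ! j\<rbrakk> * \<eta> (f l # tup ?r))" for l
      proof -
        have "(\<Sum>S\<in>Ss. F (l, S) j i) = (\<Sum>S\<in>Ss. if ?r = S
            then (-1) ^ (i + j + 1) * \<gamma> l \<lbrakk>tup T ! i, tup T ! j\<rbrakk> * \<eta> (f l # tup S) else 0)"
          unfolding F_def by (intro sum.cong) auto
        also have "\<dots> = (-1) ^ (i + j + 1) * \<gamma> l \<lbrakk>tup T ! i, tup T ! j\<rbrakk> * \<eta> (f l # tup ?r)"
          using r finSs by simp
        finally show ?thesis by (simp add: mult.assoc)
      qed
      moreover have "(\<Sum>p\<in>?N. F p j i) = (\<Sum>l<c. \<Sum>S\<in>Ss. F (l, S) j i)"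
        by (simp add: sum.cartesian_product case_prod_unfold)
      ultimately show ?thesis
        unfolding tup_rest by (simp only: sum_distrib_left)
    qed
    have "ce_differential g \<eta> (tup T) = (\<Sum>j<Suc k. \<Sum>i<j.
        (-1) ^ (i + j + 1) * \<eta> (\<lbrakk>tup T ! i, tup T ! j\<rbrakk> # nths (tup T) (- {i, j})))"
      unfolding ce_differential_def len using tup_carrier[OF TN(1)] by (simp only: if_True)
    also have "\<dots> = (\<Sum>j<Suc k. \<Sum>i<j. \<Sum>p\<in>?N. F p j i)"
      by (intro sum.cong refl summand) auto
    also have "\<dots> = (\<Sum>j<Suc k. \<Sum>p\<in>?N. \<Sum>i<j. F p j i)"
      by (intro sum.cong refl sum.swap)
    also have "\<dots> = (\<Sum>p\<in>?N. \<Sum>j<Suc k. \<Sum>i<j. F p j i)"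
      by (rule sum.swap)
    also have "\<dots> = (\<Sum>p\<in>?N. M p T * \<eta> (f (fst p) # tup (snd p)))"
      unfolding M_def F_def sum_distrib_right ..
    finally show ?thesis .
  qed

  assume "\<not> codim choose Suc k \<le> derived_dim * card {S. S \<subseteq> {..<codim} \<and> Suc (card S) = k}"
  then have "card ?N < card Ts"
    using n_subsets[of "{..<n}" "Suc k"] by (simp add: card_cartesian_product n_def c_def Ss_def Ts_def)
  from homogeneous_system_nontrivial_solution[OF _ finTs this, of M] finSs
  obtain a where a: "\<exists>T\<in>Ts. a T \<noteq> 0" "\<And>p. p \<in> ?N \<Longrightarrow> (\<Sum>T\<in>Ts. M p T * a T) = 0" by blast

  define \<omega> where "\<omega> = (\<lambda>xs. \<Sum>T\<in>Ts. a T * det_form Q \<psi> (sorted_list_of_set T) xs)"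
  have "det_form Q \<psi> (sorted_list_of_set T) \<in> alternating_forms Q (Suc k)" if "T \<in> Ts" for T
  proof -
    have T: "T \<subseteq> {..<n}" "card T = Suc k" "finite T"
      using that finite_subset[of T "{..<n}"] by (auto simp: Ts_def)
    then show ?thesis
      using det_form_alternating[OF Q_vectorspace, of "sorted_list_of_set T" \<psi>]
        dual_basis_functional[OF db] by auto
  qed
  then have \<omega>_alt: "\<omega> \<in> alternating_forms Q (Suc k)"
    unfolding \<omega>_def by (intro function_subspace_sum[OF alternating_forms_subspace finTs])
  have \<omega>_eval: "basic_form \<omega> (tup T) = a T" if T: "T \<in> Ts" for T
  proof -
    have TN: "T \<subseteq> {..<n}" "finite T" using T finite_subset[of T "{..<n}"] by (auto simp: Ts_def)
    have "map (abelianization_map g) (tup T) = map u (sorted_list_of_set T)"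
      using TN e by (auto simp: tup_def abelianization_map_def)
    then have "basic_form \<omega> (tup T) = \<omega> (map u (sorted_list_of_set T))"
      using tup_carrier[OF TN(1)] by (simp add: pullback_form_def)
    also have "\<dots> = (\<Sum>S\<in>Ts. if T = S then a S else 0)"
      unfolding \<omega>_def using T det_form_dual[OF db, of T] by (intro sum.cong) (auto simp: Ts_def)
    also have "\<dots> = a T" using T finTs by simp
    finally show ?thesis .
  qed
  obtain \<eta> where \<eta>: "\<eta> \<in> alternating_forms g k" "basic_form \<omega> = ce_differential g \<eta>"
    using exact[OF \<omega>_alt] by (auto simp: coboundaries_def)
  have "(\<Sum>T\<in>Ts. a T * a T) = (\<Sum>T\<in>Ts. \<Sum>p\<in>?N. \<eta> (f (fst p) # tup (snd p)) * (M p T * a T))"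
  proof (rule sum.cong)
    fix T assume T: "T \<in> Ts"
    have "a T = (\<Sum>p\<in>?N. M p T * \<eta> (f (fst p) # tup (snd p)))"
      using \<omega>_eval[OF T] key[OF \<eta>(1) T] \<eta>(2) by simp
    then have "a T * a T = (\<Sum>p\<in>?N. M p T * \<eta> (f (fst p) # tup (snd p))) * a T"
      by (rule arg_cong[of _ _ "\<lambda>x. x * a T"])
    also have "\<dots> = (\<Sum>p\<in>?N. \<eta> (f (fst p) # tup (snd p)) * (M p T * a T))"
      unfolding sum_distrib_right by (intro sum.cong) simp_all
    finally show "a T * a T = (\<Sum>p\<in>?N. \<eta> (f (fst p) # tup (snd p)) * (M p T * a T))" .
  qed simp
  also have "\<dots> = (\<Sum>p\<in>?N. \<eta> (f (fst p) # tup (snd p)) * (\<Sum>T\<in>Ts. M p T * a T))"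
    by (subst sum.swap) (simp only: sum_distrib_left)
  also have "\<dots> = 0" using a(2) by (intro sum.neutral) simp
  finally have "\<forall>T\<in>Ts. a T * a T = 0"
    using finTs by (subst (asm) sum_nonneg_eq_0_iff) auto
  then show False using a(1) by auto
qed

text \<open>The constant \<open>1\<close> is not a coboundary.\<close>

lemma basic_betti_number_0_nonzero:
  assumes "fin_dim"
  shows "basic_betti_number g 0 \<noteq> 0"
proof -
  define \<omega> :: "'a set list \<Rightarrow> real" where "\<omega> xs = (if xs = [] then 1 else 0)" for xs
  have "\<omega> \<in> alternating_forms Q 0" by (rule alternating_formsI) (auto simp: \<omega>_def)
  moreover have "basic_form \<omega> [] \<noteq> 0" by (simp add: \<omega>_def pullback_form_def)
  ultimately show ?thesis
    unfolding basic_betti_number_eq_0_iff[OF assms] coboundaries_def by fastforce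
qed

lemma basic_betti_number_above_codim:
  assumes "fin_dim" and "codim < k"
  shows "basic_betti_number g k = 0"
  unfolding basic_betti_number_eq_0_iff[OF assms(1)]
proof
  interpret Q: real_vectorspace Q by (rule Q_vectorspace)
  fix \<omega> assume "\<omega> \<in> alternating_forms Q k"
  then have "\<omega> = (\<lambda>_. 0)" by (rule Q.alternating_forms_above_dim[OF Q_fin_dim[OF assms(1)] assms(2)])
  then have "basic_form \<omega> = (\<lambda>_. 0)" by (simp add: pullback_form_def fun_eq_iff)
  then show "basic_form \<omega> \<in> coboundaries g k"
    using submodule.zero_closed[OF coboundaries_subspace, of g k] by simp
qed

text \<open>The greatest degree exists because degree \<open>0\<close> is nonzero and the degrees above \<open>codim\<close> vanish.\<close>

lemma independence_number_maximal:
  assumes "fin_dim"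
  shows "independence_number g \<le> codim"
    and "basic_betti_number g (Suc (independence_number g)) = 0"
proof -
  let ?P = "\<lambda>k. basic_betti_number g k \<noteq> 0"
  have bound: "k \<le> codim" if "?P k" for k
    using basic_betti_number_above_codim[OF assms, of k] that by (meson not_le)
  have P0: "?P 0" by (rule basic_betti_number_0_nonzero[OF assms])
  have "?P (independence_number g)"
    unfolding independence_number_def using GreatestI_nat[of ?P 0 codim] P0 bound by blast
  then show "independence_number g \<le> codim" by (rule bound)
  show "basic_betti_number g (Suc (independence_number g)) = 0"
    unfolding independence_number_def using Greatest_le_nat[of ?P _ codim] bound by (meson not_less_eq_eq order_refl)
qed

end

text \<open>The ratio of \<open>n choose (k + 1)\<close> to \<open>n choose (k - 1)\<close> is \<open>(n - k) (n - k + 1) / (k (k + 1))\<close>.\<close>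

lemma consecutive_product_bound:
  assumes k: "k \<le> n"
    and le: "n choose Suc k \<le> c * card {S. S \<subseteq> {..<n} \<and> Suc (card S) = k}"
  shows "(n - k) * (n - k + 1) \<le> c * (k * (k + 1))"
proof (cases k)
  case 0
  then have "{S. S \<subseteq> {..<n} \<and> Suc (card S) = k} = {}" by auto
  with 0 le show ?thesis by simp
next
  case (Suc j)
  have absorb: "Suc m * (n choose Suc m) = (n - m) * (n choose m)" for m
    by (simp only: binomial_absorption binomial_absorb_comp)
  have "{S. S \<subseteq> {..<n} \<and> Suc (card S) = k} = {S. S \<subseteq> {..<n} \<and> card S = j}"
    using Suc by auto
  then have "n choose Suc k \<le> c * (n choose j)"
    using le n_subsets[of "{..<n}" j] by simp
  then have "k * (Suc k * (n choose Suc k)) \<le> k * (Suc k * (c * (n choose j)))"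
    by (intro mult_le_mono2)
  also have "k * (Suc k * (n choose Suc k)) = (n - k) * (Suc j * (n choose Suc j))"
    unfolding absorb[of k] unfolding Suc by (rule mult.left_commute)
  also have "\<dots> = (n - k) * ((n - j) * (n choose j))" unfolding absorb ..
  finally have "(n - k) * (n - j) * (n choose j) \<le> c * (k * (k + 1)) * (n choose j)"
    by (simp only: mult_ac Suc_eq_plus1)
  moreover have "0 < n choose j" using Suc k by simp
  ultimately have "(n - k) * (n - j) \<le> c * (k * (k + 1))" by (rule mult_right_le_imp_le)
  moreover have "n - j = n - k + 1" using Suc k by simp
  ultimately show ?thesis by simp
qed

theorem theorem32:
  fixes g :: "'a lie_algebra" and d b :: nat
  assumes "two_step_nilpotent_lie_algebra g"
    and "vectorspace.fin_dim real_field g"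
    and "d = vectorspace.dim real_field g"
    and "b = betti_number g 1"
  shows "(d < b + 1 \<longrightarrow> independence_number g = d) \<and>
    (d = b + 1 \<longrightarrow> real (independence_number g) \<ge> (real d - 1) / 2) \<and>
    (d > b + 1 \<longrightarrow> real (independence_number g) \<ge>
       (sqrt (4 * (real d - real b - 1) * (real b ^ 2 + real b) + (real d + real b + 1) ^ 2)
          - (real d + real b + 1))
       / (2 * (real d - real b - 1)))"
proof -
  interpret two_step_nilpotent_lie_algebra g by (rule assms(1))
  define k c where "k = independence_number g" and "c = derived_dim"
  have b: "b = codim" using assms(4) betti_number_1[OF assms(2)] by simp
  have d: "d = b + c" using assms(3) codim_plus_derived_dim[OF assms(2)] by (simp add: b c_def)
  have kb: "k \<le> b" using independence_number_maximal(1)[OF assms(2)] by (simp add: k_def b)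
  have "b choose Suc k \<le> c * card {S. S \<subseteq> {..<b} \<and> Suc (card S) = k}"
    unfolding b c_def
    using independence_number_maximal(2)[OF assms(2)] basic_betti_number_eq_0_iff[OF assms(2)]
    by (intro vanishing_basic_cohomology_bound[OF assms(2)]) (simp add: k_def)
  then have nat_bound: "(b - k) * (b - k + 1) \<le> c * (k * (k + 1))"
    by (rule consecutive_product_bound[OF kb])
  have "real ((b - k) * (b - k + 1)) \<le> real (c * (k * (k + 1)))"
    using nat_bound by (simp only: of_nat_le_iff)
  then have bound: "(real b - real k) * (real b - real k + 1) \<le> real c * (real k * (real k + 1))"
    unfolding of_nat_diff[OF kb, symmetric] by (simp only: of_nat_mult of_nat_add of_nat_1)
  have "k = d" if "d < b + 1"
    using that nat_bound kb d by simp
  moreover have "(real d - 1) / 2 \<le> real k" if "d = b + 1"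
  proof (rule ccontr)
    assume "\<not> ?thesis"
    then have "k + 1 \<le> b - k" using that by simp
    then have "(k + 1) * (k + 2) \<le> (b - k) * (b - k + 1)" by (intro mult_le_mono) auto
    also have "\<dots> \<le> k * (k + 1)" using nat_bound that d by simp
    finally show False by simp
  qed
  moreover have "(sqrt (4 * (real d - real b - 1) * (real b ^ 2 + real b) + (real d + real b + 1) ^ 2)
          - (real d + real b + 1)) / (2 * (real d - real b - 1)) \<le> real k" if "d > b + 1"
  proof -
    define m s where "m = real d - real b - 1" and "s = real d + real b + 1"
    have m: "m > 0" and s: "s \<ge> 0" using that by (simp_all add: m_def s_def)
    \<comment> \<open>\<open>bound\<close> with \<open>d = b + c\<close> substituted and the terms collected by powers of \<open>k\<close>\<close>
    have "real b ^ 2 + real b \<le> m * real k ^ 2 + s * real k"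
      using bound by (simp add: m_def s_def d power2_eq_square algebra_simps)
    then have "4 * m * (real b ^ 2 + real b) \<le> 4 * m * (m * real k ^ 2 + s * real k)"
      using m by (intro mult_left_mono) auto
    \<comment> \<open>completing the square\<close>
    then have "4 * m * (real b ^ 2 + real b) + s ^ 2 \<le> (2 * m * real k + s) ^ 2"
      by (simp add: power2_eq_square algebra_simps)
    then have "sqrt (4 * m * (real b ^ 2 + real b) + s ^ 2) \<le> sqrt ((2 * m * real k + s) ^ 2)"
      by (rule real_sqrt_le_mono)
    also have "\<dots> = 2 * m * real k + s" using m s by simp
    finally have "(sqrt (4 * m * (real b ^ 2 + real b) + s ^ 2) - s) / (2 * m) \<le> real k"
      using m by (simp add: field_simps)
    then show ?thesis by (simp add: m_def s_def)
  qed
  ultimately show ?thesis unfolding k_def by blast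
qed

end
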